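(* Let $D\subset\mathbb{R}^d$ ($d\in\{1,2,3\}$) be a bounded Lipschitz domain, $(\Omega,\mathcal{F},P)$ a probability space, $a_0\in W^{1,\infty}(D)$ with $\min_{\overline D}a_0>0$, $\eta\in L^2(\Omega,W^{1,\infty}(D))$ with $P\{\|\eta(\omega,\cdot)\|_{W^{1,\infty}(D)}\le b_0\}=1$ for a constant $b_0>0$, and $f\in L^2(\Omega,H^{-1+\sigma}(D))$ with $\sigma\in(0,1]$. Let $\mathcal{T}_h$ be a quasi-uniform triangulation of $D$ with mesh size $h$ and $V^h_r=\{v\in H^1_0(D): v|_K\text{ is a polynomial of degree } r \text{ for each } K\in\mathcal{T}_h\}$. For each $\omega$ define $u^h_n(\omega,\cdot)\in V^h_r$ recursively by $$(a_0\nabla u^h_0(\omega,\cdot),\nabla v^h)_D=\langle f(\omega,\cdot),v^h\rangle_D\quad\forall v^h\in V^h_r,$$ $$(a_0\nabla u^h_n(\omega,\cdot),\nabla v^h)_D=-(\eta(\omega,\cdot)\nabla u^h_{n-1}(\omega,\cdot),\nabla v^h)_D\quad\forall v^h\in V^h_r,\ n\ge1.$$ Then for all $n\ge0$, $$\mathbb{E}\big(\|u^h_n\|^2_{H^1(D)}\big)\le C_0^{n+1}\,\mathbb{E}\big(\|f\|^2_{H^{-1+\sigma}(D)}\big)$$ for some constant $C_0$ independent of $n$ (and of any perturbation parameter $\varepsilon$).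
   Context: $(\cdot,\cdot)_D$ is the $L^2(D)$ inner product and $\langle\cdot,\cdot\rangle_D$ the $H^{-1}(D)\times H^1_0(D)$ duality pairing. $L^2(\Omega,X)$ denotes measurable $X$-valued maps with $\int_\Omega\|u\|_X^2dP<\infty$; $\mathbb{E}$ is expectation w.r.t. $P$; $H^{-1+\sigma}(D)$ is the dual of $H^{1-\sigma}_0(D)$. *)

theory Defs
  imports "HOL-Analysis.Analysis" "HOL-Probability.Probability"
begin

definition pderiv :: "('a::euclidean_space \<Rightarrow> real) \<Rightarrow> 'a \<Rightarrow> 'a \<Rightarrow> real" where
  "pderiv \<phi> i x = frechet_derivative \<phi> (at x) i"

fun Ck :: "nat \<Rightarrow> ('a::euclidean_space \<Rightarrow> real) \<Rightarrow> bool" where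
  "Ck 0 \<phi> = continuous_on UNIV \<phi>"
| "Ck (Suc k) \<phi> = ((\<forall>x. \<phi> differentiable (at x)) \<and> (\<forall>i\<in>Basis. Ck k (pderiv \<phi> i)))"

definition smooth :: "('a::euclidean_space \<Rightarrow> real) \<Rightarrow> bool" where
  "smooth \<phi> = (\<forall>k. Ck k \<phi>)"

definition test_fun :: "'a::euclidean_space set \<Rightarrow> ('a \<Rightarrow> real) \<Rightarrow> bool" where
  "test_fun D \<phi> = (smooth \<phi> \<and> compact (closure {x. \<phi> x \<noteq> 0}) \<and> closure {x. \<phi> x \<noteq> 0} \<subseteq> D)"

definition L2 :: "'a::euclidean_space set \<Rightarrow> ('a \<Rightarrow> real) \<Rightarrow> bool" where
  "L2 D u = (set_borel_measurable lborel D u \<and> set_integrable lborel D (\<lambda>x. (u x)^2))"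

definition L2_norm :: "'a::euclidean_space set \<Rightarrow> ('a \<Rightarrow> real) \<Rightarrow> real" where
  "L2_norm D u = sqrt (LINT x:D|lborel. (u x)^2)"

definition weak_grad :: "'a::euclidean_space set \<Rightarrow> ('a \<Rightarrow> real) \<Rightarrow> ('a \<Rightarrow> 'a) \<Rightarrow> bool" where
  "weak_grad D u G =
     ((\<forall>K. compact K \<and> K \<subseteq> D \<longrightarrow> set_integrable lborel K u \<and> set_integrable lborel K (\<lambda>x. norm (G x)))
      \<and> set_borel_measurable lborel D G
      \<and> (\<forall>\<phi>. test_fun D \<phi> \<longrightarrow> (\<forall>i\<in>Basis.
            (LINT x:D|lborel. u x * pderiv \<phi> i x) = - (LINT x:D|lborel. (G x \<bullet> i) * \<phi> x))))"

definition wgrad :: "'a::euclidean_space set \<Rightarrow> ('a \<Rightarrow> real) \<Rightarrow> 'a \<Rightarrow> 'a" where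
  "wgrad D u = (SOME G. weak_grad D u G)"

definition H1 :: "'a::euclidean_space set \<Rightarrow> ('a \<Rightarrow> real) \<Rightarrow> bool" where
  "H1 D u = (L2 D u \<and> (\<exists>G. weak_grad D u G \<and> set_integrable lborel D (\<lambda>x. (norm (G x))^2)))"

definition H1_norm :: "'a::euclidean_space set \<Rightarrow> ('a \<Rightarrow> real) \<Rightarrow> real" where
  "H1_norm D u = sqrt ((LINT x:D|lborel. (u x)^2) + (LINT x:D|lborel. (norm (wgrad D u x))^2))"

definition H10 :: "'a::euclidean_space set \<Rightarrow> ('a \<Rightarrow> real) \<Rightarrow> bool" where
  "H10 D u = (H1 D u \<and> (\<exists>\<phi>. (\<forall>k. test_fun D (\<phi> k)) \<and>
                 (\<lambda>k. H1_norm D (\<lambda>x. u x - \<phi> k x)) \<longlonglongrightarrow> 0))"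

definition gagliardo :: "'a::euclidean_space set \<Rightarrow> real \<Rightarrow> ('a \<Rightarrow> real) \<Rightarrow> ennreal" where
  "gagliardo D s v = (\<integral>\<^sup>+x. \<integral>\<^sup>+y. indicator D x * indicator D y *
       ennreal ((v x - v y)^2 / (norm (x - y)) powr (real DIM('a) + 2 * s)) \<partial>lborel \<partial>lborel)"

definition Hs_norm :: "'a::euclidean_space set \<Rightarrow> real \<Rightarrow> ('a \<Rightarrow> real) \<Rightarrow> real" where
  "Hs_norm D s v = (if s = 0 then L2_norm D v
                    else sqrt ((LINT x:D|lborel. (v x)^2) + enn2real (gagliardo D s v)))"

definition Hs0 :: "'a::euclidean_space set \<Rightarrow> real \<Rightarrow> ('a \<Rightarrow> real) \<Rightarrow> bool" where
  "Hs0 D s v = (L2 D v \<and> (s \<noteq> 0 \<longrightarrow> gagliardo D s v < \<infinity>) \<and>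
                (\<exists>\<phi>. (\<forall>k. test_fun D (\<phi> k)) \<and> (\<lambda>k. Hs_norm D s (\<lambda>x. v x - \<phi> k x)) \<longlonglongrightarrow> 0))"

definition Hneg :: "'a::euclidean_space set \<Rightarrow> real \<Rightarrow> (('a \<Rightarrow> real) \<Rightarrow> real) \<Rightarrow> bool" where
  "Hneg D s F = ((\<forall>v w a b. Hs0 D s v \<longrightarrow> Hs0 D s w \<longrightarrow>
                     F (\<lambda>x. a * v x + b * w x) = a * F v + b * F w)
               \<and> (\<exists>C. \<forall>v. Hs0 D s v \<longrightarrow> \<bar>F v\<bar> \<le> C * Hs_norm D s v))"

definition Hneg_norm :: "'a::euclidean_space set \<Rightarrow> real \<Rightarrow> (('a \<Rightarrow> real) \<Rightarrow> real) \<Rightarrow> real" where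
  "Hneg_norm D s F = Sup (insert 0 {\<bar>F v\<bar> / Hs_norm D s v | v. Hs0 D s v \<and> Hs_norm D s v \<noteq> 0})"

definition W1inf :: "'a::euclidean_space set \<Rightarrow> ('a \<Rightarrow> real) \<Rightarrow> bool" where
  "W1inf D u = (set_borel_measurable lborel D u \<and>
     (\<exists>C. AE x in lborel. x \<in> D \<longrightarrow> \<bar>u x\<bar> \<le> C) \<and>
     (\<exists>G. weak_grad D u G \<and> (\<exists>C. AE x in lborel. x \<in> D \<longrightarrow> norm (G x) \<le> C)))"

definition W1inf_norm :: "'a::euclidean_space set \<Rightarrow> ('a \<Rightarrow> real) \<Rightarrow> real" where
  "W1inf_norm D u = max (real_of_ereal (esssup (restrict_space lborel D) (\<lambda>x. ereal \<bar>u x\<bar>)))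
                        (real_of_ereal (esssup (restrict_space lborel D) (\<lambda>x. ereal (norm (wgrad D u x)))))"

definition lipschitz_domain :: "'a::euclidean_space set \<Rightarrow> bool" where
  "lipschitz_domain D = (open D \<and> connected D \<and> bounded D \<and> D \<noteq> {} \<and>
     (\<forall>x\<in>frontier D. \<exists>r>0. \<exists>e g L. norm e = 1 \<and>
        (\<forall>y z. y \<bullet> e = 0 \<longrightarrow> z \<bullet> e = 0 \<longrightarrow> \<bar>g y - g z\<bar> \<le> L * norm (y - z)) \<and>
        D \<inter> ball x r = {y \<in> ball x r. y \<bullet> e < g (y - (y \<bullet> e) *\<^sub>R e)}))"

inductive poly_fun :: "nat \<Rightarrow> ('a::euclidean_space \<Rightarrow> real) \<Rightarrow> bool" where
  const: "poly_fun n (\<lambda>x. c)"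
| lin: "poly_fun (Suc 0) (\<lambda>x. x \<bullet> b)"
| mono: "poly_fun m p \<Longrightarrow> m \<le> n \<Longrightarrow> poly_fun n p"
| add: "poly_fun n p \<Longrightarrow> poly_fun n q \<Longrightarrow> poly_fun n (\<lambda>x. p x + q x)"
| mult: "poly_fun m p \<Longrightarrow> poly_fun n q \<Longrightarrow> poly_fun (m + n) (\<lambda>x. p x * q x)"

text \<open>A triangulation is given by the set T of vertex sets of its simplices:
  each is a set of DIM+1 affinely independent points; the closed simplices cover
  closure D and are conforming (two distinct simplices meet in a common face).\<close>
definition triangulation :: "'a::euclidean_space set \<Rightarrow> 'a set set \<Rightarrow> bool" where
  "triangulation D T = (finite T \<and> T \<noteq> {} \<and>
     (\<forall>S\<in>T. finite S \<and> card S = DIM('a) + 1 \<and> \<not> affine_dependent S) \<and>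
     \<Union>((\<lambda>S. convex hull S) ` T) = closure D \<and>
     (\<forall>S1\<in>T. \<forall>S2\<in>T. S1 \<noteq> S2 \<longrightarrow> (convex hull S1) \<inter> (convex hull S2) = convex hull (S1 \<inter> S2)))"

definition mesh_size :: "'a::euclidean_space set set \<Rightarrow> real" where
  "mesh_size T = Max ((\<lambda>S. diameter (convex hull S)) ` T)"

definition quasi_uniform :: "real \<Rightarrow> 'a::euclidean_space set set \<Rightarrow> bool" where
  "quasi_uniform \<kappa> T = (\<kappa> > 0 \<and> (\<forall>S\<in>T. \<exists>x. ball x (\<kappa> * mesh_size T) \<subseteq> convex hull S))"

definition Vh :: "'a::euclidean_space set \<Rightarrow> 'a set set \<Rightarrow> nat \<Rightarrow> ('a \<Rightarrow> real) set" where
  "Vh D T r = {v. H10 D v \<and> (\<forall>S\<in>T. \<exists>p. poly_fun r p \<and> (\<forall>x\<in>convex hull S. v x = p x))}"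

definition aform :: "'a::euclidean_space set \<Rightarrow> ('a \<Rightarrow> real) \<Rightarrow> ('a \<Rightarrow> real) \<Rightarrow> ('a \<Rightarrow> real) \<Rightarrow> real" where
  "aform D a u v = (LINT x:D|lborel. a x * (wgrad D u x \<bullet> wgrad D v x))"

end

(* The Galerkin problem is coercive, so testing each equation with the solution itself gives
   |u_0| <= (K/c) |f| and |u_{n+1}| <= (b0/c) |u_n| for the L^2 norm |.| of the gradient, for almost
   every omega; squaring and integrating over Omega yields the geometric bound. The constant K comes
   from the embedding H^1_0 -> H^{1-sigma}_0, which is obtained on test functions from the
   Poincare inequality and from the estimate |phi(.+z) - phi| <= |z| |grad phi| integrated against the
   Gagliardo kernel, and extended to H^1_0 by Fatou's lemma. Since wgrad is chosen by SOME, weak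
   gradients have to be shown unique almost everywhere; this is the fundamental lemma of the calculus
   of variations, tested with smooth bumps increasing to indicators of boxes. *)

theory Submission
  imports Defs
begin

section \<open>Smooth bump functions on boxes\<close>

text \<open>The energy argument is short; most of the work guards against default values. A Bochner
  integral is 0 for a non-integrable integrand, \<open>enn2real\<close> sends infinity to 0, and so
  does \<open>real_of_ereal\<close>. Smallness of a real-valued norm therefore says nothing until
  finiteness is known, so squared norms are handled as extended nonnegative integrals
  (\<open>sqint\<close>) and turned into reals only at the end. A second obstacle is the dual norm:
  it controls \<open>f \<omega>\<close> only on \<open>Hs0\<close>. A bound on the fractional norm
  of u is thus not enough; test functions converging to u in \<open>Hs_norm\<close> must be produced
  as well. The condition \<sigma> > 0 makes s = 1 - \<sigma> less than 1, which is exactly what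
  renders |z|^2 / |z|^(d + 2 s) integrable near the origin in dimension d. The recursion is run in
  the gradient seminorm, with factor q = (b0 / c)^2 per step. The Poincare constant and the
  embedding constant enter once, through B = (16 R^2 + 1) (K / c)^2, and both are absorbed in the
  constant \<open>max 1 B * max 1 q\<close>.\<close>

lemma pderiv_eqI: "(\<phi> has_derivative f') (at x) \<Longrightarrow> pderiv \<phi> i x = f' i"
  unfolding pderiv_def by (metis frechet_derivative_at)

lemma pderiv_const: "pderiv (\<lambda>x. c) i = (\<lambda>x. 0)"
  by (rule ext, rule pderiv_eqI, rule has_derivative_const)

lemma pderiv_cmult:
  assumes "\<And>x. \<phi> differentiable (at x)"
  shows "pderiv (\<lambda>x. c * \<phi> x) i = (\<lambda>x. c * pderiv \<phi> i x)"
proof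
  fix x
  have "(\<phi> has_derivative frechet_derivative \<phi> (at x)) (at x)"
    using assms frechet_derivative_works by blast
  then show "pderiv (\<lambda>x. c * \<phi> x) i x = c * pderiv \<phi> i x"
    by (subst pderiv_eqI, auto intro!: derivative_eq_intros simp: pderiv_def)
qed

lemma pderiv_add:
  assumes "\<And>x. \<phi> differentiable (at x)" "\<And>x. \<psi> differentiable (at x)"
  shows "pderiv (\<lambda>x. \<phi> x + \<psi> x) i = (\<lambda>x. pderiv \<phi> i x + pderiv \<psi> i x)"
proof
  fix x
  have "(\<phi> has_derivative frechet_derivative \<phi> (at x)) (at x)"
    "(\<psi> has_derivative frechet_derivative \<psi> (at x)) (at x)"
    using assms frechet_derivative_works by blast+
  then show "pderiv (\<lambda>x. \<phi> x + \<psi> x) i x = pderiv \<phi> i x + pderiv \<psi> i x"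
    by (subst pderiv_eqI, auto intro!: derivative_eq_intros simp: pderiv_def)
qed

lemma pderiv_mult:
  assumes "\<And>x. \<phi> differentiable (at x)" "\<And>x. \<psi> differentiable (at x)"
  shows "pderiv (\<lambda>x. \<phi> x * \<psi> x) i = (\<lambda>x. \<phi> x * pderiv \<psi> i x + pderiv \<phi> i x * \<psi> x)"
proof
  fix x
  have "(\<phi> has_derivative frechet_derivative \<phi> (at x)) (at x)"
    "(\<psi> has_derivative frechet_derivative \<psi> (at x)) (at x)"
    using assms frechet_derivative_works by blast+
  then show "pderiv (\<lambda>x. \<phi> x * \<psi> x) i x = \<phi> x * pderiv \<psi> i x + pderiv \<phi> i x * \<psi> x"
    by (subst pderiv_eqI, auto intro!: derivative_eq_intros simp: pderiv_def)
qed

lemma Ck_const: "Ck k (\<lambda>x. c)"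
  by (induction k arbitrary: c) (auto simp: pderiv_const)

lemma Ck_Suc_D: "Ck (Suc k) \<phi> \<Longrightarrow> Ck k \<phi>"
proof (induction k arbitrary: \<phi>)
  case 0
  then show ?case
    by (auto simp: continuous_on_eq_continuous_at differentiable_imp_continuous_within)
next
  case (Suc k)
  show ?case using Suc.prems Suc.IH by (auto)
qed

lemma Ck_add: "Ck k \<phi> \<Longrightarrow> Ck k \<psi> \<Longrightarrow> Ck k (\<lambda>x. \<phi> x + \<psi> x)"
proof (induction k arbitrary: \<phi> \<psi>)
  case 0
  then show ?case by (auto intro: continuous_intros)
next
  case (Suc k)
  then show ?case by (auto simp: pderiv_add)
qed

lemma Ck_mult: "Ck k \<phi> \<Longrightarrow> Ck k \<psi> \<Longrightarrow> Ck k (\<lambda>x. \<phi> x * \<psi> x)"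
proof (induction k arbitrary: \<phi> \<psi>)
  case 0
  then show ?case by (auto intro: continuous_intros)
next
  case (Suc k)
  \<comment> \<open>The product rule leaves one factor undifferentiated in each summand, so the
    induction hypothesis is needed for \<open>\<phi>\<close> and \<open>\<psi>\<close> themselves at
    the lower order.\<close>
  have "Ck k \<phi>" "Ck k \<psi>" using Suc.prems Ck_Suc_D by blast+
  then show ?case using Suc by (auto simp: pderiv_mult intro!: Ck_add)
qed

lemma Ck_prod: "finite A \<Longrightarrow> (\<And>i. i \<in> A \<Longrightarrow> Ck k (g i)) \<Longrightarrow> Ck k (\<lambda>x. \<Prod>i\<in>A. g i x)"
  by (induction A rule: finite_induct) (auto intro: Ck_const Ck_mult)

text \<open>For m = 0 this is the classical flat function exp(-1/t). The extra power of 1/t makes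
  the family closed under differentiation up to linear combinations, so that smoothness follows by
  induction.\<close>

definition flat_exp :: "nat \<Rightarrow> real \<Rightarrow> real" where
  "flat_exp m t = (if t > 0 then exp (- inverse t) * inverse t ^ m else 0)"

text \<open>Since \<open>flat_exp m 0 = 0\<close>, this is the difference quotient at the origin.
  From the right, s = 1/h turns it into s^(m+1) / exp s as s tends to infinity; from the left it is
  identically 0.\<close>

lemma flat_quotient_tendsto:
  "((\<lambda>h. flat_exp m h / h) \<longlongrightarrow> 0) (at 0)"
proof -
  have "((\<lambda>s::real. s ^ Suc m / exp s) \<longlongrightarrow> 0) at_top"
    by (rule tendsto_power_div_exp_0)
  then have "((\<lambda>h::real. inverse h ^ Suc m / exp (inverse h)) \<longlongrightarrow> 0) (at_right 0)"
    by (rule filterlim_compose[OF _ filterlim_inverse_at_top_right])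
  moreover have "eventually (\<lambda>h::real. inverse h ^ Suc m / exp (inverse h) = flat_exp m h / h) (at_right 0)"
    by (rule eventually_at_rightI[of 0 1]) (auto simp: flat_exp_def divide_inverse exp_minus mult_ac)
  ultimately have R: "((\<lambda>h. flat_exp m h / h) \<longlongrightarrow> 0) (at_right 0)"
    by (rule Lim_transform_eventually)
  have "eventually (\<lambda>h::real. 0 = flat_exp m h / h) (at_left 0)"
    by (rule eventually_at_leftI[of "-1" 0]) (auto simp: flat_exp_def)
  then have "((\<lambda>h. flat_exp m h / h) \<longlongrightarrow> 0) (at_left 0)"
    by (rule Lim_transform_eventually[OF tendsto_const])
  with R show ?thesis by (rule filterlim_split_at[rotated])
qed

lemma flat_has_derivative:
  "(flat_exp m has_real_derivative flat_exp (m + 2) t - real m * flat_exp (m + 1) t) (at t)"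
proof -
  consider "t > 0" | "t < 0" | "t = 0" by linarith
  then show ?thesis
  proof cases
    case 1
    have i: "(inverse has_real_derivative - (inverse t ^ 2)) (at t)"
      using DERIV_inverse[of t] 1 by (simp add: numeral_2_eq_2)
    have "((\<lambda>t. exp (- inverse t) * inverse t ^ m) has_real_derivative
       exp (- inverse t) * - (- (inverse t ^ 2)) * inverse t ^ m
         + real m * (- (inverse t ^ 2) * inverse t ^ (m - Suc 0)) * exp (- inverse t)) (at t)"
      by (intro DERIV_mult DERIV_fun_exp DERIV_minus DERIV_power i)
    \<comment> \<open>For m = 0 the exponent \<open>m - Suc 0\<close> is truncated to 0, which is
      harmless because the prefactor \<open>real m\<close> vanishes.\<close>
    also have "real m * (- (inverse t ^ 2) * inverse t ^ (m - Suc 0)) = - (real m * inverse t ^ (m + 1))"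
      by (cases m) (simp_all add: power2_eq_square)
    finally have "((\<lambda>t. exp (- inverse t) * inverse t ^ m) has_real_derivative
        flat_exp (m + 2) t - real m * flat_exp (m + 1) t) (at t)"
      using 1 by (simp add: flat_exp_def power2_eq_square mult_ac)
    then show ?thesis
      by (rule has_field_derivative_transform_within_open[of _ _ _ "{0<..}"]) (use 1 in \<open>auto simp: flat_exp_def\<close>)
  next
    case 2
    have "((\<lambda>t. 0) has_real_derivative flat_exp (m + 2) t - real m * flat_exp (m + 1) t) (at t)"
      using 2 by (auto simp: flat_exp_def)
    then show ?thesis
      by (rule has_field_derivative_transform_within_open[of _ _ _ "{..<0}"]) (use 2 in \<open>auto simp: flat_exp_def\<close>)
  next
    case 3
    then show ?thesis using flat_quotient_tendsto[of m]
      by (simp add: DERIV_def flat_exp_def)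
  qed
qed

lemma flat_affine_has_derivative:
  "((\<lambda>x::'a::euclidean_space. flat_exp m (c + x \<bullet> w)) has_derivative
    (\<lambda>h. (h \<bullet> w) * (flat_exp (m + 2) (c + x \<bullet> w) - real m * flat_exp (m + 1) (c + x \<bullet> w)))) (at x)"
proof -
  have "((\<lambda>x. c + x \<bullet> w) has_derivative (\<lambda>h. h \<bullet> w)) (at x)"
    by (auto intro!: derivative_eq_intros)
  from has_derivative_compose[OF this flat_has_derivative[unfolded has_field_derivative_def]]
  show ?thesis by (simp add: mult.commute)
qed

text \<open>The induction on k keeps m arbitrary because each derivative raises m by one and by two;
  the affine inner function contributes only the constant \<open>i \<bullet> w\<close>.\<close>

lemma Ck_flat_affine: "Ck k (\<lambda>x::'a::euclidean_space. flat_exp m (c + x \<bullet> w))"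
proof (induction k arbitrary: m)
  case 0
  have "continuous (at x) (\<lambda>x::'a. flat_exp m (c + x \<bullet> w))" for x
    using flat_affine_has_derivative has_derivative_continuous by blast
  then show ?case by (simp add: continuous_on_eq_continuous_at)
next
  case (Suc k)
  have "pderiv (\<lambda>x::'a. flat_exp m (c + x \<bullet> w)) i =
     (\<lambda>x. (i \<bullet> w) * (flat_exp (m + 2) (c + x \<bullet> w) + (- real m) * flat_exp (m + 1) (c + x \<bullet> w)))" for i
    by (rule ext, subst pderiv_eqI[OF flat_affine_has_derivative]) simp
  moreover have "(\<lambda>x::'a. flat_exp m (c + x \<bullet> w)) differentiable (at x)" for x
    using flat_affine_has_derivative differentiable_def by blast
  moreover have "Ck k (\<lambda>x. (i \<bullet> w) * (flat_exp (m + 2) (c + x \<bullet> w) + (- real m) * flat_exp (m + 1) (c + x \<bullet> w)))"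
    for i by (intro Ck_mult Ck_add Ck_const Suc)
  ultimately show ?case by (simp only: Ck.simps) blast
qed

text \<open>Each coordinate carries one flat factor per face of the box, so the product is positive
  exactly inside. The scaling by \<open>Suc n\<close> sends the arguments to infinity at interior
  points, where \<open>flat_exp 0\<close> tends to 1; \<open>Suc\<close> keeps the scale positive at
  n = 0.\<close>

definition box_bump :: "'a::euclidean_space \<Rightarrow> 'a \<Rightarrow> nat \<Rightarrow> 'a \<Rightarrow> real" where
  "box_bump a b n x = (\<Prod>i\<in>Basis. flat_exp 0 (real (Suc n) * (x \<bullet> i - a \<bullet> i)) * flat_exp 0 (real (Suc n) * (b \<bullet> i - x \<bullet> i)))"

lemma box_bump_smooth: "smooth (box_bump a b n)"
proof -
  have "box_bump a b n = (\<lambda>x. \<Prod>i\<in>Basis. flat_exp 0 (- real (Suc n) * (a \<bullet> i) + x \<bullet> (real (Suc n) *\<^sub>R i))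
          * flat_exp 0 (real (Suc n) * (b \<bullet> i) + x \<bullet> (- real (Suc n) *\<^sub>R i)))"
    unfolding box_bump_def by (simp add: algebra_simps)
  moreover have "Ck k \<dots>" for k
    by (intro Ck_prod Ck_mult Ck_flat_affine finite_Basis)
  ultimately show ?thesis unfolding smooth_def by metis
qed

lemma box_bump_nonzero: "box_bump a b n x \<noteq> 0 \<longleftrightarrow> x \<in> box a b"
  unfolding box_bump_def by (auto simp: box_def flat_exp_def zero_less_mult_iff)

lemma box_bump_bounds: "0 \<le> box_bump a b n x" "box_bump a b n x \<le> 1"
proof -
  have f: "0 \<le> flat_exp 0 t" "flat_exp 0 t \<le> 1" for t by (auto simp: flat_exp_def)
  show "0 \<le> box_bump a b n x" unfolding box_bump_def by (intro prod_nonneg) (auto simp: f)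
  show "box_bump a b n x \<le> 1" unfolding box_bump_def
    by (intro prod_le_1) (auto simp: f intro: mult_le_one)
qed

lemma flat_scaled_tendsto:
  assumes "t > 0" shows "(\<lambda>n. flat_exp 0 (real (Suc n) * t)) \<longlonglongrightarrow> 1"
proof -
  have "(\<lambda>n. exp (- (inverse (real (Suc n)) * (1 / t)))) \<longlonglongrightarrow> exp (- (0 * (1 / t)))"
    by (intro tendsto_intros LIMSEQ_inverse_real_of_nat)
  moreover have "exp (- (inverse (real (Suc n)) * (1 / t))) = flat_exp 0 (real (Suc n) * t)" for n
    using assms by (simp add: flat_exp_def divide_inverse)
  ultimately show ?thesis by simp
qed

lemma box_bump_tendsto: "(\<lambda>n. box_bump a b n x) \<longlonglongrightarrow> indicator (box a b) x"
proof (cases "x \<in> box a b")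
  case True
  have "(\<lambda>n. box_bump a b n x) \<longlonglongrightarrow> (\<Prod>i\<in>(Basis::'a set). 1 * 1)"
    unfolding box_bump_def using True
    by (intro tendsto_prod tendsto_mult flat_scaled_tendsto) (auto simp: box_def)
  then show ?thesis using True by simp
next
  case False
  then have "box_bump a b n x = 0" for n using box_bump_nonzero by blast
  then show ?thesis using False by simp
qed

lemma box_bump_test_fun:
  assumes "cbox a b \<subseteq> D" shows "test_fun D (box_bump a b n)"
proof -
  have "{x. box_bump a b n x \<noteq> 0} \<subseteq> cbox a b"
    unfolding box_bump_nonzero using box_subset_cbox[of a b] by simp
  then have c: "closure {x. box_bump a b n x \<noteq> 0} \<subseteq> cbox a b"
    by (rule closure_minimal[OF _ closed_cbox])
  then have "compact (closure {x. box_bump a b n x \<noteq> 0})"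
    using compact_Int_closed[OF compact_cbox closed_closure] by (metis inf.absorb2)
  then show ?thesis using c assms box_bump_smooth unfolding test_fun_def by blast
qed

section \<open>Uniqueness of weak gradients\<close>

lemma lborel_integral_translation:
  fixes f :: "'a::euclidean_space \<Rightarrow> 'b::{banach, second_countable_topology}"
  assumes [measurable]: "f \<in> borel_measurable borel"
  shows "(\<integral>x. f (x + c) \<partial>lborel) = (\<integral>x. f x \<partial>lborel)"
proof -
  have "(\<integral>x. f x \<partial>lborel) = (\<integral>x. f x \<partial>distr lborel borel ((+) c))"
    by (simp add: lborel_distr_plus)
  also have "\<dots> = (\<integral>x. f (x + c) \<partial>lborel)"
    by (subst integral_distr) (auto simp: add.commute)
  finally show ?thesis by simp
qed

lemma lborel_integrable_translation:
  fixes f :: "'a::euclidean_space \<Rightarrow> 'b::{banach, second_countable_topology}"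
  assumes "integrable lborel f"
  shows "integrable lborel (\<lambda>x. f (x + c))"
proof -
  have [measurable]: "f \<in> borel_measurable borel" using assms by (simp add: borel_measurable_integrable)
  have "integrable (distr lborel borel ((+) c)) f"
    using assms by (simp add: lborel_distr_plus)
  then show ?thesis by (subst (asm) integrable_distr_eq) (auto simp: add.commute)
qed

lemma lborel_nn_integral_translation:
  fixes f :: "'a::euclidean_space \<Rightarrow> ennreal"
  assumes [measurable]: "f \<in> borel_measurable borel"
  shows "(\<integral>\<^sup>+x. f (x + c) \<partial>lborel) = (\<integral>\<^sup>+x. f x \<partial>lborel)"
proof -
  have "(\<integral>\<^sup>+x. f x \<partial>lborel) = (\<integral>\<^sup>+x. f x \<partial>distr lborel borel ((+) c))"
    by (simp add: lborel_distr_plus)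
  also have "\<dots> = (\<integral>\<^sup>+x. f (x + c) \<partial>lborel)"
    by (subst nn_integral_distr) (auto simp: add.commute)
  finally show ?thesis by simp
qed

text \<open>\<open>pderiv\<close> is used here with an arbitrary direction z, not only with a basis
  vector; linearity of the Frechet derivative turns the increment h z into the factor h.\<close>

lemma has_derivative_along_line:
  fixes \<phi> :: "'a::euclidean_space \<Rightarrow> real"
  assumes "\<And>x. \<phi> differentiable (at x)"
  shows "((\<lambda>s. \<phi> (x + s *\<^sub>R z)) has_real_derivative pderiv \<phi> z (x + s *\<^sub>R z)) (at s)"
proof -
  let ?y = "x + s *\<^sub>R z"
  have f: "(\<phi> has_derivative frechet_derivative \<phi> (at ?y)) (at ?y)"
    using assms frechet_derivative_works by blast
  have "((\<lambda>s. x + s *\<^sub>R z) has_derivative (\<lambda>h. h *\<^sub>R z)) (at s)"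
    by (auto intro!: derivative_eq_intros)
  from has_derivative_compose[OF this f]
  have "((\<lambda>s. \<phi> (x + s *\<^sub>R z)) has_derivative (\<lambda>h. frechet_derivative \<phi> (at ?y) (h *\<^sub>R z))) (at s)" .
  moreover have "frechet_derivative \<phi> (at ?y) (h *\<^sub>R z) = pderiv \<phi> z ?y * h" for h
    using linear_frechet_derivative[OF assms] by (simp add: linear_cmul pderiv_def)
  ultimately show ?thesis by (simp add: has_field_derivative_def mult_commute_abs)
qed

lemma pderiv_zero_outside:
  assumes "closed K" "\<And>x. x \<notin> K \<Longrightarrow> \<phi> x = 0" "x \<notin> K"
  shows "pderiv \<phi> i x = 0"
proof -
  have "((\<lambda>x. 0) has_derivative (\<lambda>h. 0)) (at x)" by simp
  then have "(\<phi> has_derivative (\<lambda>h. 0)) (at x)"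
    by (rule has_derivative_transform_within_open[of _ _ _ _ "- K"]) (use assms in auto)
  then show ?thesis by (rule pderiv_eqI)
qed

lemma integrable_continuous_compact_support:
  fixes f :: "'a::euclidean_space \<Rightarrow> real"
  assumes "continuous_on UNIV f" "compact K" "\<And>x. x \<notin> K \<Longrightarrow> f x = 0"
  shows "integrable lborel f"
proof -
  have "integrable lborel (\<lambda>x. indicator K x *\<^sub>R f x)"
    using assms by (intro borel_integrable_compact) (auto intro: continuous_on_subset)
  moreover have "(\<lambda>x. indicator K x *\<^sub>R f x) = f" using assms(3) by (force simp: indicator_def)
  ultimately show ?thesis by simp
qed

lemma bounded_continuous_compact_support:
  fixes f :: "'a::euclidean_space \<Rightarrow> real"
  assumes "continuous_on UNIV f" "compact K" "\<And>x. x \<notin> K \<Longrightarrow> f x = 0"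
  obtains B where "B \<ge> 0" "\<And>x. \<bar>f x\<bar> \<le> B"
proof -
  have "bounded (f ` K)"
    using assms by (meson compact_continuous_image compact_imp_bounded continuous_on_subset subset_UNIV)
  then obtain B where B: "B > 0" "\<forall>y\<in>f ` K. norm y \<le> B" using bounded_pos by metis
  have "\<bar>f x\<bar> \<le> B" for x using B assms(3)[of x] by (cases "x \<in> K") auto
  then show ?thesis using that[of B] B by simp
qed

text \<open>Difference quotients of \<open>\<phi>\<close> have integral 0 by translation invariance,
  and they converge pointwise to the partial derivative. The mean value theorem supplies a
  dominating function, so no iterated integration over coordinates is involved.\<close>

lemma integral_pderiv_eq_0:
  fixes \<phi> :: "'a::euclidean_space \<Rightarrow> real"
  assumes C1: "Ck 1 \<phi>" and K: "compact K" and supp: "\<And>x. x \<notin> K \<Longrightarrow> \<phi> x = 0" and i: "i \<in> Basis"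
  shows "(\<integral>x. pderiv \<phi> i x \<partial>lborel) = 0"
proof -
  have d: "\<phi> differentiable (at x)" for x using C1 by simp
  have cont: "continuous_on UNIV \<phi>" "continuous_on UNIV (pderiv \<phi> i)"
    using C1 Ck_Suc_D[of 0 \<phi>] i by auto
  have z: "x \<notin> K \<Longrightarrow> pderiv \<phi> i x = 0" for x
    using pderiv_zero_outside[of K \<phi> x i] supp K compact_imp_closed by blast
  obtain B where B: "B \<ge> 0" "\<And>x. \<bar>pderiv \<phi> i x\<bar> \<le> B"
    using bounded_continuous_compact_support[OF cont(2) K z] by blast
  have int: "integrable lborel \<phi>" using integrable_continuous_compact_support[OF cont(1) K supp] by blast
  have [measurable]: "\<phi> \<in> borel_measurable borel" "pderiv \<phi> i \<in> borel_measurable borel"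
    using cont borel_measurable_continuous_onI by blast+
  define t where "t n = inverse (real (Suc n))" for n
  define q where "q n x = (\<phi> (x + t n *\<^sub>R i) - \<phi> x) / t n" for n x
  have t: "0 < t n" "t n \<le> 1" for n by (auto simp: t_def field_simps)
  \<comment> \<open>The set swept out by moving K backwards along i by at most 1. Since
    \<open>t n \<le> 1\<close>, every difference quotient vanishes outside it, and it is compact as
    a continuous image.\<close>
  define K' where "K' = (\<lambda>(x, s). x - s *\<^sub>R i) ` (K \<times> {0..1})"
  have K': "compact K'" unfolding K'_def
    by (intro compact_continuous_image compact_Times K compact_Icc)
       (auto simp: case_prod_unfold intro!: continuous_intros)
  have mvt: "\<exists>s. 0 < s \<and> s < t n \<and> q n x = pderiv \<phi> i (x + s *\<^sub>R i)" for n x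
  proof -
    obtain s where "0 < s" "s < t n" "\<phi> (x + t n *\<^sub>R i) - \<phi> (x + 0 *\<^sub>R i) = (t n - 0) * pderiv \<phi> i (x + s *\<^sub>R i)"
      using MVT2[OF t(1), of n "\<lambda>s. \<phi> (x + s *\<^sub>R i)" "\<lambda>s. pderiv \<phi> i (x + s *\<^sub>R i)"]
        has_derivative_along_line[OF d] by blast
    then show ?thesis using t(1)[of n] by (intro exI[of _ s]) (auto simp: q_def)
  qed
  have bound: "norm (q n x) \<le> B * indicator K' x" for n x
  proof -
    obtain s where s: "0 < s" "s < t n" "q n x = pderiv \<phi> i (x + s *\<^sub>R i)" using mvt by blast
    show ?thesis
    proof (cases "x + s *\<^sub>R i \<in> K")
      case True
      then have "x \<in> K'" unfolding K'_def using s t(2)[of n]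
        by (intro image_eqI[of _ _ "(x + s *\<^sub>R i, s)"]) auto
      then show ?thesis using s(3) B(2) by simp
    next
      case False
      then show ?thesis using s(3) z B(1) by simp
    qed
  qed
  have lim: "(\<lambda>n. q n x) \<longlonglongrightarrow> pderiv \<phi> i x" for x
  proof -
    have "((\<lambda>h. (\<phi> (x + h *\<^sub>R i) - \<phi> x) / h) \<longlongrightarrow> pderiv \<phi> i x) (at 0)"
      using has_derivative_along_line[OF d, of x i 0] by (simp add: DERIV_def)
    moreover have "filterlim t (at 0) sequentially"
      unfolding filterlim_at using LIMSEQ_inverse_real_of_nat t(1)
      by (auto simp: t_def[abs_def])
    ultimately show ?thesis unfolding q_def by (rule filterlim_compose)
  qed
  have "(\<lambda>n. \<integral>x. q n x \<partial>lborel) \<longlonglongrightarrow> (\<integral>x. pderiv \<phi> i x \<partial>lborel)"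
  proof (rule integral_dominated_convergence)
    show "integrable lborel (\<lambda>x. B * indicator K' x)"
      using emeasure_bounded_finite[OF compact_imp_bounded[OF K']] K'
      by (intro integrable_mult_right integrable_real_indicator) (auto simp: borel_compact)
  qed (use lim bound in \<open>auto simp: q_def\<close>)
  moreover have "(\<integral>x. q n x \<partial>lborel) = 0" for n
    unfolding q_def using int lborel_integral_translation[of \<phi> "t n *\<^sub>R i"] lborel_integrable_translation[OF int]
    by simp
  ultimately show ?thesis by (simp add: LIMSEQ_const_iff)
qed

section \<open>From vanishing pairings to vanishing functions\<close>

lemma AE_cbox_imp_box: "AE x::'a::euclidean_space in lborel. x \<in> cbox a b \<longrightarrow> x \<in> box a b"
proof -
  have "emeasure lborel (cbox a b - box a b) = 0"
    using emeasure_Diff[of lborel "box a b" "cbox a b"] box_subset_cbox[of a b]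
    by (simp add: emeasure_lborel_cbox_eq emeasure_lborel_box_eq)
  then have "cbox a b - box a b \<in> null_sets lborel" by auto
  from AE_not_in[OF this] show ?thesis by auto
qed

text \<open>A Dynkin argument: boxes are stable under intersection and generate the Borel sets, so
  all set integrals of h vanish, and densities are unique almost everywhere. The total integral is
  what carries the step to complements.\<close>

lemma AE_eq_0_if_integrals_box:
  fixes h :: "'a::euclidean_space \<Rightarrow> real"
  assumes h: "integrable lborel h" and box: "\<And>c d. (LINT x:box c d|lborel. h x) = 0"
    and tot: "(\<integral>x. h x \<partial>lborel) = 0"
  shows "AE x in lborel. h x = 0"
proof (rule density_unique_real[OF h integrable_zero])
  fix A :: "'a set" assume "A \<in> sets lborel"
  then have "A \<in> sigma_sets UNIV (range (\<lambda>(a, b). box a b))"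
    by (simp add: borel_eq_box)
  have seq: "sigma_sets UNIV (range (\<lambda>(a, b). box a b)) = sets (borel :: 'a measure)"
    by (simp add: borel_eq_box)
  have si: "A \<in> sets borel \<Longrightarrow> set_integrable lborel A h" for A
    using integrable_mult_indicator[OF _ h, of A] by (simp add: set_integrable_def)
  have "Int_stable (range (\<lambda>(a, b). box a b :: 'a set))"
    by (auto simp: Int_stable_def box_Int_box)
  moreover have "range (\<lambda>(a, b). box a b :: 'a set) \<subseteq> Pow UNIV" by simp
  ultimately have "(LINT x:A|lborel. h x) = 0"
    using \<open>A \<in> sigma_sets UNIV (range (\<lambda>(a, b). box a b))\<close>
  proof (induction rule: sigma_sets_induct_disjoint)
    case (basic A) then show ?case using box by auto
  next
    case empty then show ?case by (simp add: set_lebesgue_integral_def)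
  next
    case (compl A)
    then have "(LINT x:UNIV|lborel. h x) = (LINT x:A|lborel. h x) + (LINT x:UNIV - A|lborel. h x)"
      unfolding seq using set_integral_Un[of A "UNIV - A" lborel h] si by (simp add: Un_absorb2)
    then show ?case using compl tot by (simp add: set_lebesgue_integral_def)
  next
    case (union A)
    then have "(LINT x:(\<Union>i. A i)|lborel. h x) = (\<Sum>i. LINT x:A i|lborel. h x)"
      unfolding seq using si by (intro lebesgue_integral_countable_add) (auto simp: disjoint_family_on_def)
    then show ?case using union by simp
  qed
  then show "(LINT x:A|lborel. h x) = (LINT x:A|lborel. 0)" by simp
qed

lemma fundamental_lemma_calculus_of_variations:
  fixes g :: "'a::euclidean_space \<Rightarrow> real"
  assumes D: "open D"
    and loc: "\<And>K. compact K \<Longrightarrow> K \<subseteq> D \<Longrightarrow> set_integrable lborel K g"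
    and zero: "\<And>\<phi>. test_fun D \<phi> \<Longrightarrow> (LINT x:D|lborel. g x * \<phi> x) = 0"
  shows "AE x in lborel. x \<in> D \<longrightarrow> g x = 0"
proof -
  \<comment> \<open>The closed box must lie in D for the bumps to be admissible. They are bounded by
    1, so g cut off to the closed box dominates, and the limit of the vanishing pairings is the
    integral over the open box.\<close>
  have 1: "(LINT x:box c d|lborel. g x) = 0" if cd: "cbox c d \<subseteq> D" for c d
  proof -
    have i: "integrable lborel (\<lambda>x. indicator (cbox c d) x *\<^sub>R g x)"
      using loc[OF compact_cbox cd] by (simp add: set_integrable_def)
    have [measurable]: "box_bump c d n \<in> borel_measurable borel" for n
      by (intro borel_measurable_continuous_onI) (use box_bump_smooth[of c d n] in \<open>auto simp: smooth_def dest: spec[of _ 0]\<close>)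
    have "(\<lambda>n. \<integral>x. (indicator (cbox c d) x *\<^sub>R g x) * box_bump c d n x \<partial>lborel)
       \<longlonglongrightarrow> (\<integral>x. (indicator (cbox c d) x *\<^sub>R g x) * indicator (box c d) x \<partial>lborel)"
    proof (rule integral_dominated_convergence[OF _ _ integrable_norm[OF i]])
      show "AE x in lborel. (\<lambda>n. indicator (cbox c d) x *\<^sub>R g x * box_bump c d n x)
              \<longlonglongrightarrow> indicator (cbox c d) x *\<^sub>R g x * indicator (box c d) x"
        by (intro AE_I2 tendsto_mult tendsto_const box_bump_tendsto)
      show "AE x in lborel. norm (indicator (cbox c d) x *\<^sub>R g x * box_bump c d n x)
              \<le> norm (indicator (cbox c d) x *\<^sub>R g x)" for n
        using box_bump_bounds[of c d n] by (intro AE_I2) (auto simp: abs_mult intro: mult_left_le)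
    qed (use i borel_measurable_integrable[OF i] in \<open>auto intro!: borel_measurable_times\<close>)
    moreover have "(\<integral>x. (indicator (cbox c d) x *\<^sub>R g x) * box_bump c d n x \<partial>lborel) = 0" for n
    proof -
      have "box_bump c d n x = 0" if "x \<notin> cbox c d" for x
        using that box_bump_nonzero box_subset_cbox by blast
      then have "(indicator (cbox c d) x *\<^sub>R g x) * box_bump c d n x = indicator D x *\<^sub>R (g x * box_bump c d n x)" for x
        using cd by (cases "x \<in> cbox c d") auto
      then show ?thesis using zero[OF box_bump_test_fun[OF cd], of n] unfolding set_lebesgue_integral_def by (simp only:)
    qed
    moreover have "(indicator (cbox c d) x *\<^sub>R g x) * indicator (box c d) x = indicator (box c d) x *\<^sub>R g x" for x
      using box_subset_cbox[of c d] by (auto simp: indicator_def)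
    ultimately show ?thesis unfolding set_lebesgue_integral_def by (simp only: LIMSEQ_const_iff)
  qed
  \<comment> \<open>As g is only locally integrable, the criterion on boxes is applied to its
    cut-off to a single box; intersections of boxes are boxes, which reduces each integral to the
    previous step.\<close>
  have 2: "AE x in lborel. x \<in> box a b \<longrightarrow> g x = 0" if ab: "cbox a b \<subseteq> D" for a b
  proof -
    have "set_integrable lborel (box a b) g"
      using loc[OF compact_cbox ab] by (rule set_integrable_subset) (auto simp: box_subset_cbox)
    then have "integrable lborel (\<lambda>x. indicator (box a b) x *\<^sub>R g x)" by (simp add: set_integrable_def)
    moreover have "(LINT x:box c d|lborel. indicator (box a b) x *\<^sub>R g x) = 0" for c d
    proof -
      obtain e f where ef: "box c d \<inter> box a b = box e f" using box_Int_box[of c d a b] by blast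
      have "(LINT x:box c d|lborel. indicator (box a b) x *\<^sub>R g x) = (LINT x:box e f|lborel. g x)"
        unfolding set_lebesgue_integral_def ef[symmetric]
        by (intro Bochner_Integration.integral_cong refl) (simp add: indicator_def)
      also have "\<dots> = 0"
      \<comment> \<open>When \<open>box e f\<close> is empty, \<open>cbox e f\<close> may be a
        degenerate box outside D, so the closure argument is reserved for the nonempty case.\<close>
      proof (cases "box e f = {}")
        case False
        have "box e f \<subseteq> box a b" using ef by blast
        then have "cbox e f \<subseteq> cbox a b"
          using closure_mono[of "box e f" "box a b"] closure_box[OF False] closure_box[of a b] False by fastforce
        then show ?thesis using 1 ab by blast
      qed (simp add: set_lebesgue_integral_def)
      finally show ?thesis .
    qed
    moreover have "(\<integral>x. indicator (box a b) x *\<^sub>R g x \<partial>lborel) = 0"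
      using 1[OF ab] by (simp add: set_lebesgue_integral_def)
    ultimately have "AE x in lborel. indicator (box a b) x *\<^sub>R g x = 0"
      by (rule AE_eq_0_if_integrals_box)
    then show ?thesis by eventually_elim (auto simp: indicator_def)
  qed
  \<comment> \<open>Countability of the cover is what permits the exceptional null sets to be
    united.\<close>
  obtain \<D> where \<D>: "countable \<D>" "\<D> \<subseteq> Pow D" "\<And>X. X \<in> \<D> \<Longrightarrow> \<exists>a b. X = cbox a b" "\<Union>\<D> = D"
    using open_countable_Union_open_cbox[OF D] by metis
  have "AE x in lborel. x \<in> X \<longrightarrow> g x = 0" if "X \<in> \<D>" for X
  proof -
    obtain a b where X: "X = cbox a b" using \<D>(3)[OF \<open>X \<in> \<D>\<close>] by blast
    then have X: "X = cbox a b" "cbox a b \<subseteq> D" using \<D>(2) \<open>X \<in> \<D>\<close> by auto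
    show ?thesis unfolding X using 2[OF X(2)] AE_cbox_imp_box[of a b] by eventually_elim auto
  qed
  then have "AE x in lborel. \<forall>X\<in>\<D>. x \<in> X \<longrightarrow> g x = 0"
    using AE_ball_countable[OF \<D>(1), of "\<lambda>x X. x \<in> X \<longrightarrow> g x = 0" lborel] by simp
  then show ?thesis by eventually_elim (use \<D>(4) in blast)
qed

definition supp :: "('a::topological_space \<Rightarrow> real) \<Rightarrow> 'a set" where
  "supp \<phi> = closure {x. \<phi> x \<noteq> 0}"

lemma closed_supp: "closed (supp \<phi>)"
  by (simp add: supp_def)

lemma zero_outside_supp: "x \<notin> supp \<phi> \<Longrightarrow> \<phi> x = 0"
  unfolding supp_def using closure_subset[of "{x. \<phi> x \<noteq> 0}"] by blast

lemma test_fun_D: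
  assumes "test_fun D \<phi>"
  shows "compact (supp \<phi>)" "supp \<phi> \<subseteq> D" "\<And>x. x \<notin> supp \<phi> \<Longrightarrow> \<phi> x = 0"
    "continuous_on UNIV \<phi>" "\<And>x. \<phi> differentiable (at x)" "Ck 1 \<phi>"
    "\<And>i. i \<in> Basis \<Longrightarrow> continuous_on UNIV (pderiv \<phi> i)"
    "\<And>i x. x \<notin> supp \<phi> \<Longrightarrow> pderiv \<phi> i x = 0"
proof -
  show "compact (supp \<phi>)" "supp \<phi> \<subseteq> D" using assms by (simp_all add: test_fun_def supp_def)
  show z: "\<And>x. x \<notin> supp \<phi> \<Longrightarrow> \<phi> x = 0" by (rule zero_outside_supp)
  have Ck: "Ck k \<phi>" for k using assms by (simp add: test_fun_def smooth_def)
  show "continuous_on UNIV \<phi>" using Ck[of 0] by (simp only: Ck.simps)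
  show "Ck 1 \<phi>" by (rule Ck)
  have C1: "(\<forall>x. \<phi> differentiable (at x)) \<and> (\<forall>i\<in>Basis. continuous_on UNIV (pderiv \<phi> i))"
    using Ck[of "Suc 0"] unfolding Ck.simps .
  show "\<phi> differentiable (at x)" for x using C1 by blast
  show "continuous_on UNIV (pderiv \<phi> i)" if "i \<in> Basis" for i using C1 that by blast
  show "pderiv \<phi> i x = 0" if "x \<notin> supp \<phi>" for i x
    by (rule pderiv_zero_outside[of "supp \<phi>" \<phi> x i, OF closed_supp _ that]) (rule z)
qed

text \<open>Local integrability is enough: the product lives on the compact support inside D, where
  \<open>\<phi>\<close> is bounded.\<close>

lemma set_integrable_times_test_fun:
  assumes \<phi>: "test_fun D \<phi>" and D: "open D"
    and loc: "\<And>K. compact K \<Longrightarrow> K \<subseteq> D \<Longrightarrow> set_integrable lborel K g"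
  shows "set_integrable lborel D (\<lambda>x. g x * \<phi> x)"
proof -
  define K where "K = supp \<phi>"
  note K = test_fun_D[OF \<phi>, folded K_def]
  obtain B where B: "\<And>x. \<bar>\<phi> x\<bar> \<le> B" "B \<ge> 0" using bounded_continuous_compact_support[OF K(4,1,3)] by blast
  have [measurable]: "\<phi> \<in> borel_measurable borel" using K(4) borel_measurable_continuous_onI by blast
  have i: "integrable lborel (\<lambda>x. indicator K x *\<^sub>R g x)" using loc[OF K(1,2)] by (simp add: set_integrable_def)
  note [measurable] = borel_measurable_integrable[OF i]
  have "integrable lborel (\<lambda>x. (indicator K x *\<^sub>R g x) * \<phi> x)"
  proof (rule Bochner_Integration.integrable_bound[OF integrable_mult_left[OF i, of B]])
    show "AE x in lborel. norm ((indicator K x *\<^sub>R g x) * \<phi> x) \<le> norm ((indicator K x *\<^sub>R g x) * B)"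
      using B by (intro AE_I2) (simp only: norm_mult, intro mult_left_mono, auto)
    show "(\<lambda>x. (indicator K x *\<^sub>R g x) * \<phi> x) \<in> borel_measurable lborel" by measurable
  qed
  moreover have "(indicator K x *\<^sub>R g x) * \<phi> x = indicator D x *\<^sub>R (g x * \<phi> x)" for x
    using K by (cases "x \<in> K") auto
  ultimately show ?thesis unfolding set_integrable_def by (simp only:)
qed

text \<open>\<open>weak_grad\<close> provides measurability of G only after restriction to D and
  integrability only of its norm. Multiplying by the indicators of K and of D yields measurability,
  comparison with the norm yields integrability.\<close>

lemma weak_grad_component_integrable:
  assumes "weak_grad D u G" "compact K" "K \<subseteq> D" "i \<in> Basis"
  shows "set_integrable lborel K (\<lambda>x. G x \<bullet> i)"
proof -
  have n: "integrable lborel (\<lambda>x. indicator K x *\<^sub>R norm (G x))"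
    using assms by (auto simp: weak_grad_def set_integrable_def)
  have "(\<lambda>x. indicator D x *\<^sub>R G x) \<in> borel_measurable lborel"
    using assms by (auto simp: weak_grad_def set_borel_measurable_def)
  then have [measurable]: "(\<lambda>x. indicator D x *\<^sub>R G x) \<in> borel_measurable borel" by simp
  have [measurable]: "K \<in> sets borel" using assms by (simp add: borel_compact)
  have "(\<lambda>x. indicator K x *\<^sub>R ((indicator D x *\<^sub>R G x) \<bullet> i)) \<in> borel_measurable borel" by measurable
  moreover have "(\<lambda>x. indicator K x *\<^sub>R ((indicator D x *\<^sub>R G x) \<bullet> i)) = (\<lambda>x. indicator K x *\<^sub>R (G x \<bullet> i))"
    using assms(3) by (intro ext) (auto simp: indicator_def)
  ultimately have m: "(\<lambda>x. indicator K x *\<^sub>R (G x \<bullet> i)) \<in> borel_measurable lborel" by simp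
  show ?thesis unfolding set_integrable_def
    by (rule Bochner_Integration.integrable_bound[OF n m])
       (auto intro!: AE_I2 mult_left_mono Basis_le_norm assms simp: abs_mult)
qed

lemma weak_grad_times_test_fun_integrable:
  assumes "open D" "weak_grad D u G" "test_fun D \<phi>" "i \<in> Basis"
  shows "set_integrable lborel D (\<lambda>x. (G x \<bullet> i) * \<phi> x)"
  by (rule set_integrable_times_test_fun[OF assms(3,1)])
    (rule weak_grad_component_integrable[OF assms(2) _ _ assms(4)])

lemma weak_grad_locally_integrable:
  "weak_grad D u G \<Longrightarrow> compact K \<Longrightarrow> K \<subseteq> D \<Longrightarrow> set_integrable lborel K u"
  by (simp add: weak_grad_def)

lemma times_test_fun_integrable:
  assumes "open D" "weak_grad D u G" "test_fun D \<phi>"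
  shows "set_integrable lborel D (\<lambda>x. u x * \<phi> x)"
  by (rule set_integrable_times_test_fun[OF assms(3,1)])
    (rule weak_grad_locally_integrable[OF assms(2)])

lemma weak_grad_D:
  assumes "weak_grad D u G" "test_fun D \<phi>" "i \<in> Basis"
  shows "(LINT x:D|lborel. u x * pderiv \<phi> i x) = - (LINT x:D|lborel. (G x \<bullet> i) * \<phi> x)"
  using assms unfolding weak_grad_def by blast

text \<open>Both candidates have the same pairing with every test function, so each component of
  their difference falls under the fundamental lemma; only finitely many null sets, one per basis
  vector, are united.\<close>

lemma weak_grad_unique:
  assumes D: "open D" and G: "weak_grad D u G" and G': "weak_grad D u G'"
  shows "AE x in lborel. x \<in> D \<longrightarrow> G x = G' x"
proof -
  have "AE x in lborel. x \<in> D \<longrightarrow> (G x - G' x) \<bullet> i = 0" if i: "i \<in> Basis" for i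
  proof (rule fundamental_lemma_calculus_of_variations[OF D])
    show "set_integrable lborel K (\<lambda>x. (G x - G' x) \<bullet> i)" if K: "compact K" "K \<subseteq> D" for K
      unfolding inner_diff_left
      by (intro set_integral_diff(1) weak_grad_component_integrable[OF G K i] weak_grad_component_integrable[OF G' K i])
    fix \<phi> assume \<phi>: "test_fun D \<phi>"
    have "(LINT x:D|lborel. (G x \<bullet> i) * \<phi> x) = (LINT x:D|lborel. (G' x \<bullet> i) * \<phi> x)"
      using weak_grad_D[OF G \<phi> i] weak_grad_D[OF G' \<phi> i] by simp
    then show "(LINT x:D|lborel. ((G x - G' x) \<bullet> i) * \<phi> x) = 0"
      unfolding inner_diff_left left_diff_distrib
      by (subst set_integral_diff(2)[OF weak_grad_times_test_fun_integrable[OF D G \<phi> i]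
            weak_grad_times_test_fun_integrable[OF D G' \<phi> i]]) simp
  qed
  then have "AE x in lborel. \<forall>i\<in>Basis. x \<in> D \<longrightarrow> (G x - G' x) \<bullet> i = 0"
    by (intro AE_finite_allI) auto
  then show ?thesis by eventually_elim (simp add: inner_diff_left euclidean_eq_iff[where 'a='a])
qed

section \<open>Approximation by test functions\<close>

definition grad :: "('a::euclidean_space \<Rightarrow> real) \<Rightarrow> 'a \<Rightarrow> 'a" where
  "grad \<phi> x = (\<Sum>i\<in>Basis. pderiv \<phi> i x *\<^sub>R i)"

lemma grad_inner_Basis: "i \<in> Basis \<Longrightarrow> grad \<phi> x \<bullet> i = pderiv \<phi> i x"
  by (simp add: grad_def inner_sum_left inner_Basis if_distrib cong: if_cong)

lemma pderiv_eq_grad_inner: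
  assumes "\<phi> differentiable (at x)"
  shows "pderiv \<phi> z x = grad \<phi> x \<bullet> z"
proof -
  have l: "linear (frechet_derivative \<phi> (at x))" using linear_frechet_derivative[OF assms] .
  have "frechet_derivative \<phi> (at x) z = frechet_derivative \<phi> (at x) (\<Sum>i\<in>Basis. (z \<bullet> i) *\<^sub>R i)"
    by (simp add: euclidean_representation)
  also have "\<dots> = (\<Sum>i\<in>Basis. (z \<bullet> i) * frechet_derivative \<phi> (at x) i)"
    using l by (simp add: linear_sum linear_cmul)
  finally show ?thesis
    unfolding pderiv_def grad_def inner_sum_left inner_scaleR_left
    by (simp add: mult.commute inner_commute[of z])
qed

lemma smooth_pderiv: "smooth \<phi> \<Longrightarrow> i \<in> Basis \<Longrightarrow> smooth (pderiv \<phi> i)"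
  unfolding smooth_def by (metis Ck.simps(2))

text \<open>Makes u times a derivative of a test function integrable, which is needed before the
  integral in the defining identity of \<open>weak_grad\<close> can be split over a
  difference.\<close>

lemma test_fun_pderiv:
  assumes "test_fun D \<phi>" "i \<in> Basis" shows "test_fun D (pderiv \<phi> i)"
proof -
  have c: "closure {x. pderiv \<phi> i x \<noteq> 0} \<subseteq> supp \<phi>"
    using test_fun_D(8)[OF assms(1)] by (intro closure_minimal closed_supp) blast
  then have "compact (closure {x. pderiv \<phi> i x \<noteq> 0})"
    using test_fun_D(1)[OF assms(1)] compact_Int_closed[OF _ closed_closure] by (metis inf.absorb2)
  then show ?thesis using assms c test_fun_D(2)[OF assms(1)] smooth_pderiv unfolding test_fun_def by blast
qed

lemma test_fun_diff:
  assumes "test_fun D \<phi>" "test_fun D \<psi>" shows "test_fun D (\<lambda>x. \<phi> x - \<psi> x)"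
proof -
  let ?K = "supp \<phi> \<union> supp \<psi>"
  have "Ck k (\<lambda>x. \<phi> x + (- 1) * \<psi> x)" for k
    using assms by (intro Ck_add Ck_mult Ck_const) (auto simp: test_fun_def smooth_def)
  then have s: "smooth (\<lambda>x. \<phi> x - \<psi> x)" by (simp add: smooth_def)
  have "{x. \<phi> x - \<psi> x \<noteq> 0} \<subseteq> ?K"
    using zero_outside_supp[of _ \<phi>] zero_outside_supp[of _ \<psi>] by force
  then have c: "closure {x. \<phi> x - \<psi> x \<noteq> 0} \<subseteq> ?K" by (intro closure_minimal closed_Un closed_supp)
  moreover have "compact ?K" using assms by (intro compact_Un test_fun_D)
  ultimately have "compact (closure {x. \<phi> x - \<psi> x \<noteq> 0})"
    using compact_Int_closed[OF _ closed_closure] by (metis inf.absorb2)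
  moreover have "?K \<subseteq> D" using assms test_fun_D(2) by blast
  ultimately show ?thesis using c s unfolding test_fun_def by blast
qed

lemma grad_diff:
  assumes "test_fun D \<phi>" "test_fun D \<psi>"
  shows "grad (\<lambda>x. \<phi> x - \<psi> x) x = grad \<phi> x - grad \<psi> x"
proof -
  have d: "\<phi> differentiable (at x)" "\<psi> differentiable (at x)" for x
    using assms test_fun_D(5) by blast+
  have "pderiv (\<lambda>x. \<phi> x + (- 1) * \<psi> x) i x = pderiv \<phi> i x - pderiv \<psi> i x" for i
    using d by (subst pderiv_add) (auto simp: pderiv_cmult[of \<psi> "-1", simplified])
  then show ?thesis by (simp add: grad_def sum_subtractf scaleR_left_diff_distrib)
qed

lemma continuous_on_grad: "test_fun D \<phi> \<Longrightarrow> continuous_on UNIV (grad \<phi>)"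
  unfolding grad_def by (intro continuous_intros) (rule test_fun_D(7))

text \<open>The defining identity is the product rule for \<open>\<phi> x * \<psi> x\<close>
  combined with the vanishing integral of a derivative; the support of \<open>\<psi>\<close> lies in
  D, so integrals over D and over the whole space agree.\<close>

lemma weak_grad_test_fun:
  assumes D: "open D" and \<phi>: "test_fun D \<phi>"
  shows "weak_grad D \<phi> (grad \<phi>)"
  unfolding weak_grad_def
proof (intro conjI allI impI ballI)
  have [measurable]: "grad \<phi> \<in> borel_measurable borel"
    using continuous_on_grad[OF \<phi>] borel_measurable_continuous_onI by blast
  show "set_borel_measurable lborel D (grad \<phi>)"
    using D by (simp add: set_borel_measurable_def)
  fix K assume K: "compact K \<and> K \<subseteq> D"
  show "set_integrable lborel K \<phi>" unfolding set_integrable_def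
    using K test_fun_D(4)[OF \<phi>] by (intro borel_integrable_compact) (auto intro: continuous_on_subset)
  show "set_integrable lborel K (\<lambda>x. norm (grad \<phi> x))" unfolding set_integrable_def
    using K continuous_on_grad[OF \<phi>]
    by (intro borel_integrable_compact continuous_on_norm) (auto intro: continuous_on_subset)
next
  fix \<psi> i assume \<psi>: "test_fun D \<psi>" and i: "i \<in> (Basis :: 'a set)"
  define K where "K = supp \<psi>"
  note K = test_fun_D[OF \<psi>, folded K_def] test_fun_D(7)[OF \<psi> i]
  note K0 = test_fun_D(4-6)[OF \<phi>] test_fun_D(7)[OF \<phi> i]
  have "(\<integral>x. pderiv (\<lambda>x. \<phi> x * \<psi> x) i x \<partial>lborel) = 0"
    using K K0 i by (intro integral_pderiv_eq_0[of _ K] Ck_mult) auto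
  moreover have 1: "integrable lborel (\<lambda>x. \<phi> x * pderiv \<psi> i x)"
    using K K0 by (intro integrable_continuous_compact_support[of _ K] continuous_intros) auto
  moreover have 2: "integrable lborel (\<lambda>x. pderiv \<phi> i x * \<psi> x)"
    using K K0 by (intro integrable_continuous_compact_support[of _ K] continuous_intros) auto
  ultimately have eq: "(\<integral>x. \<phi> x * pderiv \<psi> i x \<partial>lborel) = - (\<integral>x. pderiv \<phi> i x * \<psi> x \<partial>lborel)"
    using K K0 by (simp add: pderiv_mult)
  have e: "indicator D x *\<^sub>R (\<phi> x * pderiv \<psi> i x) = \<phi> x * pderiv \<psi> i x"
       "indicator D x *\<^sub>R (pderiv \<phi> i x * \<psi> x) = pderiv \<phi> i x * \<psi> x" for x
    using K(2,3,8) by (cases "x \<in> K"; force)+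
  show "(LINT x:D|lborel. \<phi> x * pderiv \<psi> i x) = - (LINT x:D|lborel. (grad \<phi> x \<bullet> i) * \<psi> x)"
    unfolding set_lebesgue_integral_def grad_inner_Basis[OF i] e by (rule eq)
qed

lemma weak_grad_diff:
  assumes D: "open D" and G: "weak_grad D u G" and H: "weak_grad D v H"
  shows "weak_grad D (\<lambda>x. u x - v x) (\<lambda>x. G x - H x)"
  unfolding weak_grad_def
proof (intro conjI allI impI ballI)
  have m: "(\<lambda>x. indicator D x *\<^sub>R G x) \<in> borel_measurable lborel" "(\<lambda>x. indicator D x *\<^sub>R H x) \<in> borel_measurable lborel"
    using G H by (auto simp: weak_grad_def set_borel_measurable_def)
  from borel_measurable_diff[OF this]
  show m': "set_borel_measurable lborel D (\<lambda>x. G x - H x)"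
    by (simp add: set_borel_measurable_def scaleR_diff_right)
  fix K assume K: "compact K \<and> K \<subseteq> D"
  then have KD: "K \<in> sets borel" by (simp add: borel_compact)
  show "set_integrable lborel K (\<lambda>x. u x - v x)"
    using K G H by (intro set_integral_diff(1)) (auto simp: weak_grad_def)
  have "set_integrable lborel K (\<lambda>x. norm (G x) + norm (H x))"
    using K G H by (intro set_integral_add(1)) (auto simp: weak_grad_def)
  then show "set_integrable lborel K (\<lambda>x. norm (G x - H x))" unfolding set_integrable_def
  proof (rule Bochner_Integration.integrable_bound)
    have "(\<lambda>x. indicator K x *\<^sub>R norm (indicator D x *\<^sub>R (G x - H x))) \<in> borel_measurable lborel"
      using KD by (intro borel_measurable_scaleR measurable_compose[OF m'[unfolded set_borel_measurable_def] borel_measurable_norm]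
          borel_measurable_indicator) simp
    moreover have "(\<lambda>x. indicator K x *\<^sub>R norm (indicator D x *\<^sub>R (G x - H x))) = (\<lambda>x. indicator K x *\<^sub>R norm (G x - H x))"
      using K by (intro ext) (auto simp: indicator_def)
    ultimately show "(\<lambda>x. indicator K x *\<^sub>R norm (G x - H x)) \<in> borel_measurable lborel" by (simp only:)
  qed (auto simp: indicator_def norm_triangle_ineq4)
next
  fix \<psi> i assume \<psi>: "test_fun D \<psi>" and i: "i \<in> (Basis :: 'a set)"
  show "(LINT x:D|lborel. (u x - v x) * pderiv \<psi> i x) = - (LINT x:D|lborel. ((G x - H x) \<bullet> i) * \<psi> x)"
    unfolding inner_diff_left left_diff_distrib
      set_integral_diff(2)[OF times_test_fun_integrable[OF D G test_fun_pderiv[OF \<psi> i]]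
        times_test_fun_integrable[OF D H test_fun_pderiv[OF \<psi> i]]]
      set_integral_diff(2)[OF weak_grad_times_test_fun_integrable[OF D G \<psi> i]
        weak_grad_times_test_fun_integrable[OF D H \<psi> i]]
    using weak_grad_D[OF G \<psi> i] weak_grad_D[OF H \<psi> i] by simp
qed

section \<open>Squared L2 norms as extended nonnegative integrals\<close>

definition sqint :: "'a::euclidean_space set \<Rightarrow> ('a \<Rightarrow> 'b::real_normed_vector) \<Rightarrow> ennreal" where
  "sqint D f = (\<integral>\<^sup>+x. indicator D x * ennreal ((norm (f x))^2) \<partial>lborel)"

lemma set_integral_norm_sq_nonneg: "0 \<le> (LINT x:D|M. (norm (f x))\<^sup>2)"
  unfolding set_lebesgue_integral_def by (rule Bochner_Integration.integral_nonneg) simp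

lemma sqint_measurable:
  fixes f :: "'a::euclidean_space \<Rightarrow> 'b::euclidean_space"
  assumes "set_borel_measurable lborel D f"
  shows "(\<lambda>x. indicator D x * ennreal ((norm (f x))^2)) \<in> borel_measurable lborel"
    "(\<lambda>x. indicator D x *\<^sub>R ((norm (f x))^2)) \<in> borel_measurable lborel"
proof -
  have [measurable]: "(\<lambda>x. indicator D x *\<^sub>R f x) \<in> borel_measurable lborel"
    using assms by (simp add: set_borel_measurable_def)
  have "(\<lambda>x. ennreal ((norm (indicator D x *\<^sub>R f x))^2)) \<in> borel_measurable lborel" 
      "(\<lambda>x. ((norm (indicator D x *\<^sub>R f x))^2)) \<in> borel_measurable lborel" by measurable
  moreover have "(\<lambda>x. ennreal ((norm (indicator D x *\<^sub>R f x))^2)) = (\<lambda>x. indicator D x * ennreal ((norm (f x))^2))"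
      "(\<lambda>x. ((norm (indicator D x *\<^sub>R f x))^2)) = (\<lambda>x. indicator D x *\<^sub>R ((norm (f x))^2))"
    by (intro ext, auto simp: indicator_def)+
  ultimately show "(\<lambda>x. indicator D x * ennreal ((norm (f x))^2)) \<in> borel_measurable lborel"
    "(\<lambda>x. indicator D x *\<^sub>R ((norm (f x))^2)) \<in> borel_measurable lborel" by (simp_all only:)
qed

lemma sqint_indicator: "sqint D f = (\<integral>\<^sup>+x. ennreal (norm (indicator D x *\<^sub>R ((norm (f x))^2))) \<partial>lborel)"
  unfolding sqint_def by (intro nn_integral_cong) (auto simp: indicator_def)

lemma set_integrable_iff_sqint:
  fixes f :: "'a::euclidean_space \<Rightarrow> 'b::euclidean_space"
  assumes "set_borel_measurable lborel D f"
  shows "set_integrable lborel D (\<lambda>x. (norm (f x))^2) \<longleftrightarrow> sqint D f < \<infinity>"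
  unfolding set_integrable_def integrable_iff_bounded sqint_indicator
  using sqint_measurable(2)[OF assms] by simp

lemma sqint_eq_integral:
  assumes "set_integrable lborel D (\<lambda>x. (norm (f x))^2)"
  shows "sqint D f = ennreal (LINT x:D|lborel. (norm (f x))^2)"
  unfolding sqint_indicator set_lebesgue_integral_def
  by (simp add: nn_integral_eq_integral[OF assms[unfolded set_integrable_def], simplified])

lemma sqint_cong_AE: "(AE x in lborel. x \<in> D \<longrightarrow> norm (f x) = norm (g x)) \<Longrightarrow> sqint D f = sqint D g"
  unfolding sqint_def by (intro nn_integral_cong_AE) (auto elim!: eventually_mono simp: indicator_def)

text \<open>The inequality (a + b)^2 \<le> 2 a^2 + 2 b^2 replaces Minkowski's: it stays on squared
  norms and holds for infinite values too. The price is a factor 2 at every splitting, visible in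
  the later constants.\<close>

lemma sqint_add_le:
  fixes f g h :: "'a::euclidean_space \<Rightarrow> 'b::euclidean_space"
  assumes "set_borel_measurable lborel D f" "set_borel_measurable lborel D g"
    and "\<And>x. x \<in> D \<Longrightarrow> norm (h x) \<le> norm (f x) + norm (g x)"
  shows "sqint D h \<le> 2 * sqint D f + 2 * sqint D g"
proof -
  note m = sqint_measurable(1)[OF assms(1)] sqint_measurable(1)[OF assms(2)]
  have "sqint D h \<le> (\<integral>\<^sup>+x. 2 * (indicator D x * ennreal ((norm (f x))^2)) + 2 * (indicator D x * ennreal ((norm (g x))^2)) \<partial>lborel)"
    unfolding sqint_def
  proof (intro nn_integral_mono)
    fix x
    show "indicator D x * ennreal ((norm (h x))^2) \<le> 2 * (indicator D x * ennreal ((norm (f x))^2)) + 2 * (indicator D x * ennreal ((norm (g x))^2))"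
    proof (cases "x \<in> D")
      case True
      have "(norm (h x))^2 \<le> (norm (f x) + norm (g x))^2"
        using assms(3)[OF True] by (intro power_mono) auto
      also have "\<dots> \<le> 2 * (norm (f x))^2 + 2 * (norm (g x))^2"
        using sum_squares_bound[of "norm (f x)" "norm (g x)"] by (simp add: power2_sum)
      finally have "ennreal ((norm (h x))^2) \<le> ennreal (2 * (norm (f x))^2 + 2 * (norm (g x))^2)"
        by (rule ennreal_leI)
      also have "\<dots> = 2 * ennreal ((norm (f x))^2) + 2 * ennreal ((norm (g x))^2)"
        by (simp add: ennreal_plus ennreal_mult)
      finally show ?thesis using True by simp
    qed simp
  qed
  also have "\<dots> = 2 * sqint D f + 2 * sqint D g"
    unfolding sqint_def using m by (subst nn_integral_add) (auto simp: nn_integral_cmult)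
  finally show ?thesis .
qed

lemma sqint_diff_le:
  fixes f g :: "'a::euclidean_space \<Rightarrow> 'b::euclidean_space"
  assumes "set_borel_measurable lborel D f" "set_borel_measurable lborel D g"
  shows "sqint D (\<lambda>x. f x - g x) \<le> 2 * sqint D f + 2 * sqint D g"
  by (rule sqint_add_le[OF assms norm_triangle_ineq4])

lemma sqint_diff_less_top:
  fixes f g :: "'a::euclidean_space \<Rightarrow> 'b::euclidean_space"
  assumes "set_borel_measurable lborel D f" "set_borel_measurable lborel D g"
    and "sqint D f < \<infinity>" "sqint D g < \<infinity>"
  shows "sqint D (\<lambda>x. f x - g x) < \<infinity>"
proof -
  have "2 * sqint D f + 2 * sqint D g < \<infinity>"
    using assms(3,4) by (simp add: ennreal_mult_less_top)
  with sqint_diff_le[OF assms(1,2)] show ?thesis by (rule order.strict_trans1)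
qed

lemma sqint_le_diff:
  fixes f g :: "'a::euclidean_space \<Rightarrow> 'b::euclidean_space"
  assumes "set_borel_measurable lborel D (\<lambda>x. f x - g x)" "set_borel_measurable lborel D g"
  shows "sqint D f \<le> 2 * sqint D (\<lambda>x. f x - g x) + 2 * sqint D g"
  using norm_triangle_sub[of "f _" "g _"] by (intro sqint_add_le[OF assms]) (simp add: add.commute)

lemma set_borel_measurable_diff:
  fixes f g :: "'a \<Rightarrow> 'b::euclidean_space"
  assumes "set_borel_measurable M D f" "set_borel_measurable M D g"
  shows "set_borel_measurable M D (\<lambda>x. f x - g x)"
  using borel_measurable_diff[OF assms[unfolded set_borel_measurable_def]]
  by (simp add: set_borel_measurable_def scaleR_diff_right)

lemma set_borel_measurable_continuous_UNIV:
  fixes f :: "'a::euclidean_space \<Rightarrow> 'b::euclidean_space"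
  assumes "open D" "continuous_on UNIV f"
  shows "set_borel_measurable lborel D f"
proof -
  have [measurable]: "f \<in> borel_measurable borel"
    using assms borel_measurable_continuous_onI by blast
  show ?thesis using assms by (simp add: set_borel_measurable_def)
qed

lemma test_fun_sqint_finite:
  assumes D: "open D" and \<phi>: "test_fun D \<phi>"
  shows "set_borel_measurable lborel D \<phi>" "sqint D \<phi> < \<infinity>"
proof -
  note K = test_fun_D(1,3,4)[OF \<phi>]
  show m: "set_borel_measurable lborel D \<phi>"
    using set_borel_measurable_continuous_UNIV[OF D K(3)] .
  have "integrable lborel (\<lambda>x. (norm (\<phi> x))^2)"
    using K by (intro integrable_continuous_compact_support[of _ "supp \<phi>"] continuous_intros) auto
  then have "set_integrable lborel D (\<lambda>x. (norm (\<phi> x))^2)"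
    unfolding set_integrable_def using D by (intro integrable_mult_indicator) auto
  then show "sqint D \<phi> < \<infinity>" using set_integrable_iff_sqint[OF m] by simp
qed

lemma L2_iff_sqint: "L2 D u \<longleftrightarrow> set_borel_measurable lborel D u \<and> sqint D u < \<infinity>"
  unfolding L2_def using set_integrable_iff_sqint[of D u] by auto

text \<open>The choice in \<open>wgrad\<close> returns some weak gradient, not necessarily the
  square-integrable witness in \<open>H1\<close>; uniqueness almost everywhere transfers the finite
  norm.\<close>

lemma H1_wgrad:
  assumes D: "open D" and u: "H1 D u"
  shows "weak_grad D u (wgrad D u)" "set_borel_measurable lborel D (wgrad D u)" "sqint D (wgrad D u) < \<infinity>"
proof -
  obtain G where G: "weak_grad D u G" "set_integrable lborel D (\<lambda>x. (norm (G x))^2)"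
    using u by (auto simp: H1_def)
  show w: "weak_grad D u (wgrad D u)" unfolding wgrad_def by (rule someI[of "weak_grad D u", OF G(1)])
  then show m: "set_borel_measurable lborel D (wgrad D u)" by (simp add: weak_grad_def)
  have "AE x in lborel. x \<in> D \<longrightarrow> wgrad D u x = G x"
    using weak_grad_unique[OF D w G(1)] .
  then have "sqint D (wgrad D u) = sqint D G"
    by (intro sqint_cong_AE) (auto elim!: eventually_mono)
  moreover have "set_borel_measurable lborel D G" using G(1) by (simp add: weak_grad_def)
  ultimately show "sqint D (wgrad D u) < \<infinity>" using set_integrable_iff_sqint G(2) by metis
qed

lemma H1_norm_sq:
  assumes D: "open D" and u: "H1 D u"
  shows "ennreal ((H1_norm D u)^2) = sqint D u + sqint D (wgrad D u)"
proof -
  have 1: "set_integrable lborel D (\<lambda>x. (norm (u x))^2)" using u by (simp add: H1_def L2_def)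
  have 2: "set_integrable lborel D (\<lambda>x. (norm (wgrad D u x))^2)"
    using H1_wgrad[OF D u] set_integrable_iff_sqint by blast
  have n: "0 \<le> (LINT x:D|lborel. (norm (u x))^2)" "0 \<le> (LINT x:D|lborel. (norm (wgrad D u x))^2)"
    by (rule set_integral_norm_sq_nonneg)+
  then have "(H1_norm D u)^2 = (LINT x:D|lborel. (norm (u x))^2) + (LINT x:D|lborel. (norm (wgrad D u x))^2)"
    by (simp add: H1_norm_def)
  then show ?thesis using n by (simp add: sqint_eq_integral[OF 1] sqint_eq_integral[OF 2] ennreal_plus)
qed

text \<open>\<open>H1_norm\<close> of a difference refers to a fresh choice of weak gradient,
  unrelated by definition to \<open>wgrad D u\<close>. Identifying it almost everywhere with the
  difference of gradients makes the convergence in \<open>H10\<close> usable.\<close>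

lemma H1_diff_test_fun:
  assumes D: "open D" and u: "H1 D u" and \<phi>: "test_fun D \<phi>"
  shows "H1 D (\<lambda>x. u x - \<phi> x)"
    and "AE x in lborel. x \<in> D \<longrightarrow> wgrad D (\<lambda>x. u x - \<phi> x) x = wgrad D u x - grad \<phi> x"
proof -
  note w = H1_wgrad[OF D u]
  have wd: "weak_grad D (\<lambda>x. u x - \<phi> x) (\<lambda>x. wgrad D u x - grad \<phi> x)"
    by (rule weak_grad_diff[OF D w(1) weak_grad_test_fun[OF D \<phi>]])
  have mg: "set_borel_measurable lborel D (grad \<phi>)"
    using set_borel_measurable_continuous_UNIV[OF D continuous_on_grad[OF \<phi>]] .
  note K = test_fun_D(1,3,8)[OF \<phi>]
  have "integrable lborel (\<lambda>x. (norm (grad \<phi> x))^2)"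
    using K by (intro integrable_continuous_compact_support[of _ "supp \<phi>"] continuous_intros continuous_on_grad[OF \<phi>]) (auto simp: grad_def)
  then have "set_integrable lborel D (\<lambda>x. (norm (grad \<phi> x))^2)"
    unfolding set_integrable_def using D by (intro integrable_mult_indicator) auto
  then have "sqint D (grad \<phi>) < \<infinity>" using set_integrable_iff_sqint[OF mg] by simp
  then have "sqint D (\<lambda>x. wgrad D u x - grad \<phi> x) < \<infinity>"
    using sqint_diff_less_top[OF w(2) mg w(3)] by simp
  then have i: "set_integrable lborel D (\<lambda>x. (norm (wgrad D u x - grad \<phi> x))^2)"
    using set_integrable_iff_sqint[OF set_borel_measurable_diff[OF w(2) mg]] by simp
  have "L2 D u" using u by (simp add: H1_def)
  then have "L2 D (\<lambda>x. u x - \<phi> x)"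
    using sqint_diff_less_top[of D u \<phi>] set_borel_measurable_diff[of lborel D u \<phi>] test_fun_sqint_finite[OF D \<phi>]
    by (simp add: L2_iff_sqint)
  then show H: "H1 D (\<lambda>x. u x - \<phi> x)" unfolding H1_def using wd i by blast
  show "AE x in lborel. x \<in> D \<longrightarrow> wgrad D (\<lambda>x. u x - \<phi> x) x = wgrad D u x - grad \<phi> x"
    by (rule weak_grad_unique[OF D H1_wgrad(1)[OF D H] wd])
qed

text \<open>The squared norm is the sum of the two \<open>sqint\<close> terms, so each tends to 0
  separately. The pointwise limit is added for the later use of Fatou's lemma.\<close>

lemma H10_approx:
  assumes D: "open D" and u: "H10 D u"
  obtains \<phi> where "\<And>k. test_fun D (\<phi> k)"
    "(\<lambda>k. sqint D (\<lambda>x. u x - \<phi> k x)) \<longlonglongrightarrow> 0"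
    "(\<lambda>k. sqint D (\<lambda>x. wgrad D u x - grad (\<phi> k) x)) \<longlonglongrightarrow> 0"
    "AE x in lborel. x \<in> D \<longrightarrow> (\<lambda>k. \<phi> k x) \<longlonglongrightarrow> u x"
proof -
  have H1: "H1 D u" using u by (simp add: H10_def)
  obtain \<phi> where \<phi>: "\<And>k. test_fun D (\<phi> k)" and lim: "(\<lambda>k. H1_norm D (\<lambda>x. u x - \<phi> k x)) \<longlonglongrightarrow> 0"
    using u by (auto simp: H10_def)
  have "(\<lambda>k. (H1_norm D (\<lambda>x. u x - \<phi> k x))^2) \<longlonglongrightarrow> 0^2"
    by (intro tendsto_intros lim)
  then have "(\<lambda>k. ennreal ((H1_norm D (\<lambda>x. u x - \<phi> k x))^2)) \<longlonglongrightarrow> 0"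
    using tendsto_ennrealI by fastforce
  moreover have "ennreal ((H1_norm D (\<lambda>x. u x - \<phi> k x))^2) =
     sqint D (\<lambda>x. u x - \<phi> k x) + sqint D (\<lambda>x. wgrad D u x - grad (\<phi> k) x)" for k
  proof -
    note d = H1_diff_test_fun[OF D H1 \<phi>, of k]
    have "sqint D (wgrad D (\<lambda>x. u x - \<phi> k x)) = sqint D (\<lambda>x. wgrad D u x - grad (\<phi> k) x)"
      using d(2) by (intro sqint_cong_AE) (auto elim!: eventually_mono)
    then show ?thesis using H1_norm_sq[OF D d(1)] by simp
  qed
  ultimately have s: "(\<lambda>k. sqint D (\<lambda>x. u x - \<phi> k x) + sqint D (\<lambda>x. wgrad D u x - grad (\<phi> k) x)) \<longlonglongrightarrow> 0"
    by simp
  have l1: "(\<lambda>k. sqint D (\<lambda>x. u x - \<phi> k x)) \<longlonglongrightarrow> 0"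
    by (rule tendsto_sandwich[OF _ _ tendsto_const s]) auto
  have l2: "(\<lambda>k. sqint D (\<lambda>x. wgrad D u x - grad (\<phi> k) x)) \<longlonglongrightarrow> 0"
    by (rule tendsto_sandwich[OF _ _ tendsto_const s]) auto
  have i: "set_integrable lborel D (\<lambda>x. (norm (u x - \<phi> k x))^2)" for k
    using H1_diff_test_fun(1)[OF D H1 \<phi>, of k] by (simp add: H1_def L2_def)
  have "(\<lambda>k. LINT x:D|lborel. (norm (u x - \<phi> k x))^2) \<longlonglongrightarrow> 0"
  proof -
    have n: "0 \<le> (LINT x:D|lborel. (norm (u x - \<phi> k x))^2)" for k
      by (rule set_integral_norm_sq_nonneg)
    have "(\<lambda>k. ennreal (LINT x:D|lborel. (norm (u x - \<phi> k x))^2)) \<longlonglongrightarrow> ennreal 0"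
      using l1 sqint_eq_integral[OF i] by simp
    then show ?thesis using n by (subst (asm) tendsto_ennreal_iff) auto
  qed
  moreover have "norm (indicator D x *\<^sub>R (norm (u x - \<phi> k x))^2) = indicator D x *\<^sub>R (norm (u x - \<phi> k x))^2" for k x
    by simp
  ultimately have "(\<lambda>k. \<integral>x. norm (indicator D x *\<^sub>R (norm (u x - \<phi> k x))^2) \<partial>lborel) \<longlonglongrightarrow> 0"
    by (simp only: set_lebesgue_integral_def)
  \<comment> \<open>The squares tend to 0 in L1, which gives almost everywhere convergence along a
    subsequence; passing to it preserves both norm limits.\<close>
  from tendsto_L1_AE_subseq[OF i[unfolded set_integrable_def] this]
  obtain r :: "nat \<Rightarrow> nat" where r: "strict_mono r"
    "AE x in lborel. (\<lambda>n. indicator D x *\<^sub>R (norm (u x - \<phi> (r n) x))^2) \<longlonglongrightarrow> 0" by blast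
  have "AE x in lborel. x \<in> D \<longrightarrow> (\<lambda>k. \<phi> (r k) x) \<longlonglongrightarrow> u x"
    using r(2)
  proof eventually_elim
    case (elim x)
    show ?case
    proof
      assume "x \<in> D"
      then have "(\<lambda>n. sqrt ((norm (u x - \<phi> (r n) x))^2)) \<longlonglongrightarrow> sqrt 0"
        using elim by (intro tendsto_real_sqrt) simp
      then have "(\<lambda>n. norm (\<phi> (r n) x - u x)) \<longlonglongrightarrow> 0" by (simp add: abs_minus_commute)
      then show "(\<lambda>k. \<phi> (r k) x) \<longlonglongrightarrow> u x" using LIM_zero_iff tendsto_norm_zero_iff by blast
    qed
  qed
  then show ?thesis
    using that[of "\<phi> \<circ> r"] \<phi> LIMSEQ_subseq_LIMSEQ[OF l1 r(1)] LIMSEQ_subseq_LIMSEQ[OF l2 r(1)]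
    by (simp add: o_def)
qed

section \<open>Poincare and Gagliardo estimates for test functions\<close>

lemma sqint_eq_UNIV:
  assumes "\<And>x. x \<notin> D \<Longrightarrow> f x = 0"
  shows "sqint D f = (\<integral>\<^sup>+x. ennreal ((norm (f x))^2) \<partial>lborel)"
  unfolding sqint_def
proof (rule nn_integral_cong)
  fix x show "indicator D x * ennreal ((norm (f x))^2) = ennreal ((norm (f x))^2)"
    using assms[of x] by (cases "x \<in> D") auto
qed

lemma test_fun_zero_outside:
  assumes "test_fun D \<phi>" "x \<notin> D"
  shows "\<phi> x = 0" "grad \<phi> x = 0"
proof -
  have "x \<notin> supp \<phi>" using test_fun_D(2)[OF assms(1)] assms(2) by blast
  then show "\<phi> x = 0" "grad \<phi> x = 0" using test_fun_D(3,8)[OF assms(1)] by (simp_all add: grad_def)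
qed

lemma Ck_inner: "Ck k (\<lambda>x::'a::euclidean_space. x \<bullet> w)"
proof (cases k)
  case 0 then show ?thesis by (auto intro!: continuous_intros)
next
  case (Suc n)
  have d: "((\<lambda>x. x \<bullet> w) has_derivative (\<lambda>h. h \<bullet> w)) (at x)" for x :: 'a
    by (auto intro!: derivative_eq_intros)
  then have "pderiv (\<lambda>x. x \<bullet> w) i = (\<lambda>x. i \<bullet> w)" for i :: 'a
    by (intro ext pderiv_eqI)
  moreover have "(\<lambda>x. x \<bullet> w) differentiable (at x)" for x :: 'a using d differentiable_def by blast
  ultimately show ?thesis using Suc by (simp add: Ck_const)
qed

lemma pderiv_inner: "pderiv (\<lambda>x. x \<bullet> w) i x = i \<bullet> w"
  by (rule pderiv_eqI) (auto intro!: derivative_eq_intros)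

text \<open>Integrating \<open>\<partial>\<^sub>i (\<phi>\<^sup>2 x\<^sub>i)\<close> over the whole space gives
  \<open>\<integral>\<phi>\<^sup>2 = - 2 \<integral>\<phi> \<partial>\<^sub>i\<phi> x\<^sub>i\<close>, and Young's inequality absorbs half of the left-hand side.\<close>

lemma poincare_test_fun:
  fixes D :: "'a::euclidean_space set"
  assumes \<phi>: "test_fun D \<phi>" and R: "\<And>x. x \<in> D \<Longrightarrow> norm x \<le> R"
  shows "sqint D \<phi> \<le> ennreal (4 * R\<^sup>2) * sqint D (grad \<phi>)"
proof -
  obtain i :: 'a where i: "i \<in> Basis" using nonempty_Basis by blast
  note K = test_fun_D[OF \<phi>] 
  let ?p = "pderiv \<phi> i" and ?W = "\<lambda>x. \<phi> x * \<phi> x * (x \<bullet> i)"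
  have Cp: "continuous_on UNIV ?p" by (rule K(7)[OF i])
  note cont = integrable_continuous_compact_support[of _ "supp \<phi>"]
  have W: "(\<integral>x. pderiv ?W i x \<partial>lborel) = 0"
    using K i by (intro integral_pderiv_eq_0[of _ "supp \<phi>"] Ck_mult Ck_inner) auto
  have dd: "(\<lambda>x. \<phi> x * \<phi> x) differentiable (at x)" "(\<lambda>x. x \<bullet> i) differentiable (at x)" for x
    using Ck_mult[OF K(6) K(6)] Ck_inner[of 1 i] by simp_all
  have pW: "pderiv ?W i x = (\<phi> x)\<^sup>2 + 2 * \<phi> x * ?p x * (x \<bullet> i)" for x
    using pderiv_mult[OF dd] pderiv_mult[OF K(5) K(5)] i
    by (simp add: pderiv_inner power2_eq_square algebra_simps)
  have I1: "integrable lborel (\<lambda>x. (\<phi> x)\<^sup>2)"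
    using K by (intro cont continuous_intros) auto
  have I2: "integrable lborel (\<lambda>x. (norm (grad \<phi> x))\<^sup>2)"
    using K by (intro cont continuous_intros continuous_on_grad[OF \<phi>]) (auto simp: grad_def)
  have I3: "integrable lborel (pderiv ?W i)"
    unfolding pW[abs_def] using K Cp by (intro cont continuous_intros) auto
  have pt: "(\<phi> x)\<^sup>2 / 2 - 2 * R\<^sup>2 * (norm (grad \<phi> x))\<^sup>2 \<le> pderiv ?W i x" for x
  proof (cases "x \<in> D")
    case True
    have "\<bar>x \<bullet> i\<bar> \<le> R" using R[OF True] Basis_le_norm[OF i, of x] by linarith
    then have x: "(x \<bullet> i)\<^sup>2 \<le> R\<^sup>2" using power_mono[of "\<bar>x \<bullet> i\<bar>" R 2] by simp
    have g: "(?p x)\<^sup>2 \<le> (norm (grad \<phi> x))\<^sup>2"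
      using Basis_le_norm[OF i, of "grad \<phi> x"] grad_inner_Basis[OF i, of \<phi> x]
        power_mono[of "\<bar>?p x\<bar>" "norm (grad \<phi> x)" 2] by simp
    have "(?p x)\<^sup>2 * (x \<bullet> i)\<^sup>2 \<le> (norm (grad \<phi> x))\<^sup>2 * R\<^sup>2"
      by (rule mult_mono[OF g x]) auto
    \<comment> \<open>Young's inequality with the weight chosen so that exactly half of the square
      of \<open>\<phi>\<close> remains on the left after integration; this produces the constant
      4.\<close>
    moreover have "0 \<le> (\<phi> x + 2 * (?p x * (x \<bullet> i)))\<^sup>2" by simp
    then have "- (2 * \<phi> x * ?p x * (x \<bullet> i)) \<le> (\<phi> x)\<^sup>2 / 2 + 2 * ((?p x)\<^sup>2 * (x \<bullet> i)\<^sup>2)"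
      by (simp add: power2_eq_square algebra_simps)
    moreover have "2 * R\<^sup>2 * (norm (grad \<phi> x))\<^sup>2 = 2 * ((norm (grad \<phi> x))\<^sup>2 * R\<^sup>2)" by simp
    ultimately show ?thesis unfolding pW by linarith
  next
    case False
    then show ?thesis unfolding pW using test_fun_zero_outside[OF \<phi> False] by simp
  qed
  have "(\<integral>x. (\<phi> x)\<^sup>2 / 2 - 2 * R\<^sup>2 * (norm (grad \<phi> x))\<^sup>2 \<partial>lborel) \<le> 0"
    unfolding W[symmetric] using I1 I2 I3 pt by (intro integral_mono) auto
  then have le: "(\<integral>x. (\<phi> x)\<^sup>2 \<partial>lborel) \<le> 4 * R\<^sup>2 * (\<integral>x. (norm (grad \<phi> x))\<^sup>2 \<partial>lborel)"
    using I1 I2 by simp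
  have s: "sqint D \<phi> = ennreal (\<integral>x. (\<phi> x)\<^sup>2 \<partial>lborel)"
    using nn_integral_eq_integral[OF I1] sqint_eq_UNIV[of D \<phi>] test_fun_zero_outside[OF \<phi>] by simp
  have s': "sqint D (grad \<phi>) = ennreal (\<integral>x. (norm (grad \<phi> x))\<^sup>2 \<partial>lborel)"
    using nn_integral_eq_integral[OF I2] sqint_eq_UNIV[of D "grad \<phi>"] test_fun_zero_outside[OF \<phi>] by simp
  show ?thesis unfolding s s' using le by (simp add: ennreal_mult[symmetric] ennreal_leI)
qed

section \<open>Fractional seminorm of a test function\<close>

lemma square_difference_le_integral:
  fixes F :: "real \<Rightarrow> real"
  assumes F: "\<And>t. (F has_real_derivative g t) (at t)" and g: "continuous_on UNIV g"
  shows "ennreal ((F 1 - F 0)\<^sup>2) \<le> (\<integral>\<^sup>+t. indicator {0..1} t * ennreal ((g t)\<^sup>2) \<partial>lborel)"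
proof -
  define m where "m = F 1 - F 0"
  let ?I = "indicator {0..1::real} :: real \<Rightarrow> real"
  have 1: "has_bochner_integral lborel (\<lambda>t. g t * ?I t) m"
    unfolding m_def using F g
    by (intro has_bochner_integral_FTC_Icc_real) (auto simp: continuous_on_eq_continuous_at)
  have 2: "integrable lborel (\<lambda>t. ?I t *\<^sub>R (g t)\<^sup>2)"
    by (intro borel_integrable_compact continuous_intros continuous_on_subset[OF g]) auto
  have 3: "has_bochner_integral lborel ?I 1"
    using has_bochner_integral_real_indicator[of "{0..1::real}" lborel] by simp
  have i1: "integrable lborel (\<lambda>t. g t * ?I t)" "(\<integral>t. g t * ?I t \<partial>lborel) = m"
    using 1 by (auto simp: has_bochner_integral_iff)
  have i3: "integrable lborel ?I" "(\<integral>t. ?I t \<partial>lborel) = 1"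
    using 3 by (auto simp: has_bochner_integral_iff)
  \<comment> \<open>Jensen's inequality on the unit interval: m is the mean of g there, and the
    integral of (g - m)^2 is nonnegative.\<close>
  have "0 \<le> (\<integral>t. ?I t *\<^sub>R (g t)\<^sup>2 - 2 * m * (g t * ?I t) + m\<^sup>2 * ?I t \<partial>lborel)"
  proof (rule Bochner_Integration.integral_nonneg)
    fix t
    have "?I t *\<^sub>R (g t)\<^sup>2 - 2 * m * (g t * ?I t) + m\<^sup>2 * ?I t = ?I t * (g t - m)\<^sup>2"
      by (simp add: power2_eq_square algebra_simps)
    then show "0 \<le> ?I t *\<^sub>R (g t)\<^sup>2 - 2 * m * (g t * ?I t) + m\<^sup>2 * ?I t" by simp
  qed
  also have "\<dots> = (\<integral>t. ?I t *\<^sub>R (g t)\<^sup>2 \<partial>lborel) - 2 * m * m + m\<^sup>2 * 1"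
  proof -
    have "(\<integral>t. ?I t *\<^sub>R (g t)\<^sup>2 - 2 * m * (g t * ?I t) + m\<^sup>2 * ?I t \<partial>lborel)
      = (\<integral>t. ?I t *\<^sub>R (g t)\<^sup>2 - 2 * m * (g t * ?I t) \<partial>lborel) + (\<integral>t. m\<^sup>2 * ?I t \<partial>lborel)"
      by (intro Bochner_Integration.integral_add Bochner_Integration.integrable_diff
          integrable_mult_right 2 i1(1) i3(1))
    also have "(\<integral>t. ?I t *\<^sub>R (g t)\<^sup>2 - 2 * m * (g t * ?I t) \<partial>lborel)
      = (\<integral>t. ?I t *\<^sub>R (g t)\<^sup>2 \<partial>lborel) - (\<integral>t. 2 * m * (g t * ?I t) \<partial>lborel)"
      by (intro Bochner_Integration.integral_diff integrable_mult_right 2 i1(1))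
    finally show ?thesis by (simp only: integral_mult_right_zero i1(2) i3(2))
  qed
  finally have "m\<^sup>2 \<le> (\<integral>t. ?I t *\<^sub>R (g t)\<^sup>2 \<partial>lborel)" by (simp add: power2_eq_square)
  then have "ennreal (m\<^sup>2) \<le> ennreal (\<integral>t. ?I t *\<^sub>R (g t)\<^sup>2 \<partial>lborel)" by (rule ennreal_leI)
  also have "\<dots> = (\<integral>\<^sup>+t. ennreal (?I t *\<^sub>R (g t)\<^sup>2) \<partial>lborel)"
    by (rule nn_integral_eq_integral[OF 2, symmetric]) simp
  also have "\<dots> = (\<integral>\<^sup>+t. indicator {0..1} t * ennreal ((g t)\<^sup>2) \<partial>lborel)"
    by (rule nn_integral_cong) (simp split: split_indicator)
  finally show ?thesis unfolding m_def .
qed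

text \<open>The increment is bounded by the integral of the squared directional derivative along the
  segment from x to x + z. After exchanging the integrals, translation invariance makes the inner
  one independent of the position t on the segment.\<close>

lemma translation_estimate_test_fun:
  fixes D :: "'a::euclidean_space set"
  assumes \<phi>: "test_fun D \<phi>"
  shows "(\<integral>\<^sup>+x. ennreal ((\<phi> (x + z) - \<phi> x)\<^sup>2) \<partial>lborel) \<le> ennreal ((norm z)\<^sup>2) * sqint D (grad \<phi>)"
proof -
  have d: "\<And>x. \<phi> differentiable (at x)" by (rule test_fun_D(5)[OF \<phi>])
  have cg: "continuous_on UNIV (grad \<phi>)" by (rule continuous_on_grad[OF \<phi>])
  have [measurable]: "grad \<phi> \<in> borel_measurable borel"
    using cg borel_measurable_continuous_onI by blast
  let ?G = "\<lambda>x. ennreal ((norm (grad \<phi> x))\<^sup>2)"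
  have pt: "ennreal ((\<phi> (x + z) - \<phi> x)\<^sup>2) \<le>
    (\<integral>\<^sup>+t. indicator {0..1} t * (ennreal ((norm z)\<^sup>2) * ?G (x + t *\<^sub>R z)) \<partial>lborel)" for x
  proof -
    have "continuous_on UNIV (\<lambda>t. grad \<phi> (x + t *\<^sub>R z) \<bullet> z)"
      by (intro continuous_intros continuous_on_compose2[OF cg]) auto
    then have "ennreal ((\<phi> (x + 1 *\<^sub>R z) - \<phi> (x + 0 *\<^sub>R z))\<^sup>2) \<le>
      (\<integral>\<^sup>+t. indicator {0..1} t * ennreal ((grad \<phi> (x + t *\<^sub>R z) \<bullet> z)\<^sup>2) \<partial>lborel)"
      using has_derivative_along_line[OF d, of x z] pderiv_eq_grad_inner[OF d, of z]
      by (intro square_difference_le_integral) auto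
    also have "\<dots> \<le> (\<integral>\<^sup>+t. indicator {0..1} t * (ennreal ((norm z)\<^sup>2) * ?G (x + t *\<^sub>R z)) \<partial>lborel)"
    proof (intro nn_integral_mono mult_left_mono)
      fix t
      have "(grad \<phi> (x + t *\<^sub>R z) \<bullet> z)\<^sup>2 \<le> (norm z)\<^sup>2 * (norm (grad \<phi> (x + t *\<^sub>R z)))\<^sup>2"
        using Cauchy_Schwarz_ineq2[of "grad \<phi> (x + t *\<^sub>R z)" z]
          power_mono[of "\<bar>grad \<phi> (x + t *\<^sub>R z) \<bullet> z\<bar>" "norm (grad \<phi> (x + t *\<^sub>R z)) * norm z" 2]
        by (simp add: power_mult_distrib mult.commute)
      then show "ennreal ((grad \<phi> (x + t *\<^sub>R z) \<bullet> z)\<^sup>2) \<le> ennreal ((norm z)\<^sup>2) * ?G (x + t *\<^sub>R z)"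
        by (simp add: ennreal_mult[symmetric] ennreal_leI)
    qed auto
    finally show ?thesis by simp
  qed
  have "(\<integral>\<^sup>+x. ennreal ((\<phi> (x + z) - \<phi> x)\<^sup>2) \<partial>lborel) \<le>
    (\<integral>\<^sup>+x. \<integral>\<^sup>+t. indicator {0..1::real} t * (ennreal ((norm z)\<^sup>2) * ?G (x + t *\<^sub>R z)) \<partial>lborel \<partial>lborel)"
    by (rule nn_integral_mono) (rule pt)
  also have "\<dots> = (\<integral>\<^sup>+t. \<integral>\<^sup>+x. indicator {0..1::real} t * (ennreal ((norm z)\<^sup>2) * ?G (x + t *\<^sub>R z)) \<partial>lborel \<partial>lborel)"
    by (rule lborel_pair.Fubini'[symmetric]) measurable
  also have "\<dots> = (\<integral>\<^sup>+t. indicator {0..1::real} t * (ennreal ((norm z)\<^sup>2) * sqint D (grad \<phi>)) \<partial>lborel)"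
  proof (rule nn_integral_cong)
    fix t :: real
    have "(\<integral>\<^sup>+x. ?G (x + t *\<^sub>R z) \<partial>lborel) = (\<integral>\<^sup>+x. ?G x \<partial>lborel)"
      by (rule lborel_nn_integral_translation) measurable
    also have "\<dots> = sqint D (grad \<phi>)"
      using sqint_eq_UNIV[of D "grad \<phi>"] test_fun_zero_outside(2)[OF \<phi>] by simp
    finally show "(\<integral>\<^sup>+x. indicator {0..1::real} t * (ennreal ((norm z)\<^sup>2) * ?G (x + t *\<^sub>R z)) \<partial>lborel) =
      indicator {0..1::real} t * (ennreal ((norm z)\<^sup>2) * sqint D (grad \<phi>))"
      by (simp add: nn_integral_cmult)
  qed
  also have "\<dots> = ennreal ((norm z)\<^sup>2) * sqint D (grad \<phi>)"
    by (simp add: nn_integral_multc)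
  finally show ?thesis .
qed

text \<open>The integral of |z|^(2 - p) over a ball: |z|^2 comes from the translation estimate, p is
  the Gagliardo exponent. The type argument carries the dimension, which R and p do not
  reveal.\<close>

definition kernel_mass :: "'a::euclidean_space itself \<Rightarrow> real \<Rightarrow> real \<Rightarrow> ennreal" where
  "kernel_mass (t :: 'a itself) R p =
    (\<integral>\<^sup>+z. indicator (cball 0 R) z * ennreal ((norm z)\<^sup>2 / norm z powr p) \<partial>(lborel :: 'a measure))"

text \<open>Choose k so that a lies in the shell between R / 2^(k+1) and R / 2^k; the outer radius
  bounds the numerator and the inner radius bounds the denominator.\<close>

lemma dyadic_bound:
  assumes z: "0 < (a::real)" "a \<le> R" and p: "p \<ge> 0"
  shows "\<exists>k. a \<le> R / 2 ^ k \<and> a\<^sup>2 / a powr p \<le> (R / 2 ^ k)\<^sup>2 / (R / 2 ^ Suc k) powr p"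
proof -
  have R: "R > 0" using z by simp
  obtain n where "(1/2::real) ^ n < a / R" using real_arch_pow_inv[of "a / R" "1/2"] z R by auto
  then have "\<exists>n. R / 2 ^ n < a" using R by (intro exI[of _ n]) (simp add: field_simps)
  then have L: "R / 2 ^ (LEAST n. R / 2 ^ n < a) < a" by (rule LeastI_ex)
  \<comment> \<open>The hypothesis a \<le> R excludes index 0, so the least index has a predecessor;
    minimality makes that predecessor an outer radius.\<close>
  then have "(LEAST n. R / 2 ^ n < a) \<noteq> 0" using z by (intro notI) simp
  then obtain k where k: "(LEAST n. R / 2 ^ n < a) = Suc k" using not0_implies_Suc by blast
  have k1: "a \<le> R / 2 ^ k" using not_less_Least[of k "\<lambda>n. R / 2 ^ n < a"] k by simp
  have k2: "R / 2 ^ Suc k < a" using L k by simp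
  have "a\<^sup>2 / a powr p \<le> (R / 2 ^ k)\<^sup>2 / (R / 2 ^ Suc k) powr p"
    using k1 k2 z R p by (intro frac_le power_mono powr_mono2) (auto intro!: less_imp_le)
  then show ?thesis using k1 by blast
qed

text \<open>The integrand is dominated by a sum of constants times indicators of concentric balls.
  Full balls rather than shells overestimate, but have an explicit volume and still give a geometric
  series.\<close>

lemma kernel_mass_finite:
  fixes p R :: real
  assumes p: "0 \<le> p" "p < real DIM('a::euclidean_space) + 2" and R: "R > 0"
  shows "kernel_mass TYPE('a) R p < \<infinity>"
proof -
  let ?d = "DIM('a)"
  define c where "c k = (R / 2 ^ k)\<^sup>2 / (R / 2 ^ Suc k) powr p" for k :: nat
  define V where "V = unit_ball_vol (real ?d)"
  \<comment> \<open>The ratio of consecutive terms: halving the radius contributes 2^(-2) through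
    the square, 2^(-d) through the volume and 2^p through the denominator. It is below 1 because p <
    d + 2.\<close>
  define \<rho> where "\<rho> = (1/2) ^ (?d + 2) / (1/2) powr p"
  have V: "V \<ge> 0" by (simp add: V_def)
  have c0: "c k \<ge> 0" for k by (simp add: c_def)
  have "(1/2::real) powr (?d + 2) < (1/2) powr p"
    using p by (intro powr_less_mono') auto
  moreover have "(1/2::real) ^ (?d + 2) = (1/2) powr (?d + 2)"
    by (subst powr_realpow[symmetric]) auto
  ultimately have "\<rho> < 1" unfolding \<rho>_def by (simp only: divide_less_eq_1_pos powr_gt_zero)
  then have \<rho>: "0 \<le> \<rho>" "\<rho> < 1" by (simp_all add: \<rho>_def)
  have pw: "((1/2::real) ^ k) powr p = ((1/2) powr p) ^ k" for k
    by (induction k) (simp_all add: powr_divide)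
  have trm: "c k * (V * (R / 2 ^ k) ^ ?d) = (R\<^sup>2 / (R / 2) powr p * V * R ^ ?d) * \<rho> ^ k" for k
  proof -
    have "(R / 2 ^ Suc k) powr p = ((R / 2) * (1/2) ^ k) powr p"
      by (simp add: power_divide)
    also have "\<dots> = (R / 2) powr p * ((1/2) powr p) ^ k"
      using R by (subst powr_mult) (auto simp: pw)
    finally have e: "(R / 2 ^ Suc k) powr p = (R / 2) powr p * ((1/2) powr p) ^ k" .
    have r: "\<rho> ^ k = ((1/2) ^ k) ^ (?d + 2) / ((1/2) powr p) ^ k"
      unfolding \<rho>_def power_divide power_mult[symmetric] by (simp add: mult.commute power_mult[symmetric] power_divide)
    have h: "R / 2 ^ k = R * (1/2) ^ k" by (simp add: power_divide)
    show ?thesis unfolding c_def e r unfolding h by (simp add: power_mult_distrib power_add power2_eq_square)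
  qed
  have "kernel_mass TYPE('a) R p \<le> (\<integral>\<^sup>+z. (\<Sum>k. ennreal (c k) * indicator (cball 0 (R / 2 ^ k)) z) \<partial>(lborel :: 'a measure))"
    unfolding kernel_mass_def
  proof (rule nn_integral_mono)
    fix z :: 'a
    show "indicator (cball 0 R) z * ennreal ((norm z)\<^sup>2 / norm z powr p) \<le> (\<Sum>k. ennreal (c k) * indicator (cball 0 (R / 2 ^ k)) z)"
    proof (cases "z \<in> cball 0 R \<and> z \<noteq> 0")
      case True
      then obtain k where k: "norm z \<le> R / 2 ^ k" "(norm z)\<^sup>2 / norm z powr p \<le> c k"
        using dyadic_bound[of "norm z" R p] p(1) unfolding c_def by auto
      have "indicator (cball 0 R) z * ennreal ((norm z)\<^sup>2 / norm z powr p) \<le> ennreal (c k) * indicator (cball 0 (R / 2 ^ k)) z"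
        using True k by (simp add: ennreal_leI)
      also have "\<dots> \<le> (\<Sum>k. ennreal (c k) * indicator (cball 0 (R / 2 ^ k)) z)"
      proof -
        define f where "f k = ennreal (c k) * indicator (cball 0 (R / 2 ^ k)) z" for k
        have "sum f {k} \<le> suminf f" by (rule sum_le_suminf) auto
        then show ?thesis by (simp add: f_def[symmetric])
      qed
      finally show ?thesis .
    next
      case False
      then show ?thesis by (cases "z = 0") auto
    qed
  qed
  also have "\<dots> = (\<Sum>k. ennreal (c k) * emeasure lborel (cball (0::'a) (R / 2 ^ k)))"
    by (subst nn_integral_suminf)
      (auto simp: nn_integral_cmult_indicator intro!: borel_measurable_times_ennreal borel_measurable_indicator)
  also have "\<dots> = (\<Sum>k. ennreal ((R\<^sup>2 / (R / 2) powr p * V * R ^ ?d) * \<rho> ^ k))"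
    unfolding trm[symmetric] using R c0 V
    by (intro arg_cong[where f=suminf] ext)
      (simp add: emeasure_cball V_def[symmetric] ennreal_mult[symmetric])
  also have "\<dots> < \<infinity>"
    using \<rho> V R by (subst suminf_ennreal2) (auto intro!: summable_mult summable_geometric)
  finally show ?thesis .
qed

text \<open>With z = y - x, confinement of D cuts the kernel off at |z| \<le> R, after which x may
  range over the whole space. Exchanging the integrals leaves, for each z, a translation difference
  to estimate.\<close>

lemma gagliardo_test_fun:
  fixes D :: "'a::euclidean_space set"
  assumes \<phi>: "test_fun D \<phi>" and R: "\<And>x y. x \<in> D \<Longrightarrow> y \<in> D \<Longrightarrow> norm (y - x) \<le> R"
  shows "gagliardo D s \<phi> \<le> kernel_mass TYPE('a) R (real DIM('a) + 2 * s) * sqint D (grad \<phi>)"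
proof -
  let ?p = "real DIM('a) + 2 * s"
  have [measurable]: "\<phi> \<in> borel_measurable borel"
    using test_fun_D(4)[OF \<phi>] borel_measurable_continuous_onI by blast
  have [measurable]: "cball (0::'a) R \<in> sets borel" by simp
  let ?H = "\<lambda>z x. indicator (cball 0 R) z * ennreal ((\<phi> (x + z) - \<phi> x)\<^sup>2 / norm z powr ?p)"
  have "gagliardo D s \<phi> \<le> (\<integral>\<^sup>+x. \<integral>\<^sup>+y. ?H (y - x) x \<partial>lborel \<partial>lborel)"
    unfolding gagliardo_def
  proof (intro nn_integral_mono)
    fix x y :: 'a
    show "indicator D x * indicator D y * ennreal ((\<phi> x - \<phi> y)\<^sup>2 / norm (x - y) powr ?p) \<le> ?H (y - x) x"
      using R[of x y] by (cases "x \<in> D \<and> y \<in> D") (auto simp: norm_minus_commute power2_commute)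
  qed
  also have "\<dots> = (\<integral>\<^sup>+x. \<integral>\<^sup>+z. ?H z x \<partial>lborel \<partial>lborel)"
  proof (rule nn_integral_cong)
    fix x :: 'a
    have "(\<integral>\<^sup>+z. ?H z x \<partial>lborel) = (\<integral>\<^sup>+y. ?H (y + (- x)) x \<partial>lborel)"
      by (rule lborel_nn_integral_translation[symmetric]) measurable
    then show "(\<integral>\<^sup>+y. ?H (y - x) x \<partial>lborel) = (\<integral>\<^sup>+z. ?H z x \<partial>lborel)" by simp
  qed
  also have "\<dots> = (\<integral>\<^sup>+z. \<integral>\<^sup>+x. ?H z x \<partial>lborel \<partial>lborel)"
    by (rule lborel_pair.Fubini'[symmetric]) measurable
  also have "\<dots> \<le> (\<integral>\<^sup>+z. indicator (cball 0 R) z * ennreal ((norm z)\<^sup>2 / norm z powr ?p) * sqint D (grad \<phi>) \<partial>(lborel :: 'a measure))"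
  proof (rule nn_integral_mono)
    fix z :: 'a
    have "(\<integral>\<^sup>+x. ?H z x \<partial>lborel) = (\<integral>\<^sup>+x. indicator (cball 0 R) z * ennreal (1 / norm z powr ?p) * ennreal ((\<phi> (x + z) - \<phi> x)\<^sup>2) \<partial>lborel)"
      by (intro nn_integral_cong) (simp add: mult.assoc ennreal_mult[symmetric])
    also have "\<dots> = indicator (cball 0 R) z * ennreal (1 / norm z powr ?p) * (\<integral>\<^sup>+x. ennreal ((\<phi> (x + z) - \<phi> x)\<^sup>2) \<partial>lborel)"
      by (rule nn_integral_cmult) measurable
    also have "\<dots> \<le> indicator (cball 0 R) z * ennreal (1 / norm z powr ?p) * (ennreal ((norm z)\<^sup>2) * sqint D (grad \<phi>))"
      by (intro mult_left_mono translation_estimate_test_fun[OF \<phi>]) simp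
    also have "\<dots> = indicator (cball 0 R) z * (ennreal (1 / norm z powr ?p) * ennreal ((norm z)\<^sup>2)) * sqint D (grad \<phi>)"
      by (simp add: mult.assoc)
    also have "ennreal (1 / norm z powr ?p) * ennreal ((norm z)\<^sup>2) = ennreal ((norm z)\<^sup>2 / norm z powr ?p)"
      by (simp add: ennreal_mult[symmetric])
    finally show "(\<integral>\<^sup>+x. ?H z x \<partial>lborel) \<le> indicator (cball 0 R) z * ennreal ((norm z)\<^sup>2 / norm z powr ?p) * sqint D (grad \<phi>)" .
  qed
  also have "\<dots> = kernel_mass TYPE('a) R ?p * sqint D (grad \<phi>)"
    unfolding kernel_mass_def by (rule nn_integral_multc) measurable
  finally show ?thesis .
qed

text \<open>Fatou's lemma is used twice, in y for almost every fixed x and then in x; with iterated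
  integrals the null set of the pointwise limit in the single variable suffices.\<close>

lemma gagliardo_Fatou:
  fixes D :: "'a::euclidean_space set"
  assumes D: "open D" and w: "\<And>l. continuous_on UNIV (w l)"
    and lim: "AE x in lborel. x \<in> D \<longrightarrow> (\<lambda>l::nat. w l x) \<longlonglongrightarrow> v x"
  shows "gagliardo D s v \<le> liminf (\<lambda>l. gagliardo D s (w l))"
proof -
  have [measurable]: "w l \<in> borel_measurable borel" for l
    using w borel_measurable_continuous_onI by blast
  have [measurable]: "D \<in> sets borel" using D by simp
  let ?p = "real DIM('a) + 2 * s"
  let ?F = "\<lambda>l x y. indicator D x * indicator D y * ennreal ((w l x - w l y)\<^sup>2 / norm (x - y) powr ?p)"
  have "gagliardo D s v \<le> (\<integral>\<^sup>+x. liminf (\<lambda>l. \<integral>\<^sup>+y. ?F l x y \<partial>lborel) \<partial>lborel)"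
    unfolding gagliardo_def
  proof (rule nn_integral_mono_AE)
    show "AE x in lborel. (\<integral>\<^sup>+y. indicator D x * indicator D y * ennreal ((v x - v y)\<^sup>2 / norm (x - y) powr ?p) \<partial>lborel)
        \<le> liminf (\<lambda>l. \<integral>\<^sup>+y. ?F l x y \<partial>lborel)"
      using lim
    proof eventually_elim
      case (elim x)
      have "(\<integral>\<^sup>+y. indicator D x * indicator D y * ennreal ((v x - v y)\<^sup>2 / norm (x - y) powr ?p) \<partial>lborel)
         \<le> (\<integral>\<^sup>+y. liminf (\<lambda>l. ?F l x y) \<partial>lborel)"
      proof (rule nn_integral_mono_AE)
        show "AE y in lborel. indicator D x * indicator D y * ennreal ((v x - v y)\<^sup>2 / norm (x - y) powr ?p) \<le> liminf (\<lambda>l. ?F l x y)"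
          using lim
        proof eventually_elim
          case (elim y)
          show ?case
          proof (cases "x \<in> D \<and> y \<in> D")
            case True
            then have l: "(\<lambda>l. w l x) \<longlonglongrightarrow> v x" "(\<lambda>l. w l y) \<longlonglongrightarrow> v y"
              using elim \<open>x \<in> D \<longrightarrow> (\<lambda>l. w l x) \<longlonglongrightarrow> v x\<close> by auto
            \<comment> \<open>Multiplying by a fixed inverse instead of dividing covers the diagonal
              x = y as well, where the inverse of 0 is 0 by convention.\<close>
            have "(\<lambda>l. ennreal ((w l x - w l y)\<^sup>2 * inverse (norm (x - y) powr ?p))) \<longlonglongrightarrow> ennreal ((v x - v y)\<^sup>2 * inverse (norm (x - y) powr ?p))"
              by (intro tendsto_ennrealI tendsto_intros l)
            then have "liminf (\<lambda>l. ennreal ((w l x - w l y)\<^sup>2 / norm (x - y) powr ?p)) = ennreal ((v x - v y)\<^sup>2 / norm (x - y) powr ?p)"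
              unfolding divide_inverse by (rule lim_imp_Liminf[rotated]) simp
            then show ?thesis using True by simp
          qed auto
        qed
      qed
      also have "\<dots> \<le> liminf (\<lambda>l. \<integral>\<^sup>+y. ?F l x y \<partial>lborel)"
        by (rule nn_integral_liminf) measurable
      finally show ?case .
    qed
  qed
  also have "\<dots> \<le> liminf (\<lambda>l. \<integral>\<^sup>+x. \<integral>\<^sup>+y. ?F l x y \<partial>lborel \<partial>lborel)"
    by (rule nn_integral_liminf) measurable
  finally show ?thesis unfolding gagliardo_def .
qed

section \<open>Estimates on H10 and for the bilinear form\<close>

lemma Hs_norm_sq:
  assumes v: "L2 D v" and g: "gagliardo D s v < \<infinity>"
  shows "ennreal ((Hs_norm D s v)\<^sup>2) \<le> sqint D v + gagliardo D s v"
proof -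
  have 1: "set_integrable lborel D (\<lambda>x. (norm (v x))\<^sup>2)" using v by (simp add: L2_def)
  have n: "0 \<le> (LINT x:D|lborel. (norm (v x))\<^sup>2)" by (rule set_integral_norm_sq_nonneg)
  show ?thesis
  proof (cases "s = 0")
    case True
    then have "(Hs_norm D s v)\<^sup>2 = (LINT x:D|lborel. (norm (v x))\<^sup>2)"
      using n by (simp add: Hs_norm_def L2_norm_def)
    then show ?thesis by (simp add: sqint_eq_integral[OF 1])
  next
    case False
    then have "(Hs_norm D s v)\<^sup>2 = (LINT x:D|lborel. (norm (v x))\<^sup>2) + enn2real (gagliardo D s v)"
      using n by (simp add: Hs_norm_def)
    then show ?thesis using n g by (simp add: sqint_eq_integral[OF 1] ennreal_plus ennreal_enn2real)
  qed
qed

lemma Hs_norm_nonneg: "0 \<le> Hs_norm D s v"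
  using set_integral_norm_sq_nonneg[of lborel D v] by (auto simp: Hs_norm_def L2_norm_def)

lemma sqint_minus_commute:
  fixes f g :: "'a::euclidean_space \<Rightarrow> 'b::real_normed_vector"
  shows "sqint D (\<lambda>x. f x - g x) = sqint D (\<lambda>x. g x - f x)"
  unfolding sqint_def by (simp add: norm_minus_commute)

lemma sqint_grad_le:
  assumes D: "open D" and u: "H1 D u" and \<phi>: "test_fun D \<phi>"
  shows "sqint D (grad \<phi>) \<le> 2 * sqint D (\<lambda>x. wgrad D u x - grad \<phi> x) + 2 * sqint D (wgrad D u)"
proof -
  have mg: "set_borel_measurable lborel D (grad \<phi>)"
    using set_borel_measurable_continuous_UNIV[OF D continuous_on_grad[OF \<phi>]] .
  note w = H1_wgrad[OF D u]
  show ?thesis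
    using sqint_le_diff[OF set_borel_measurable_diff[OF mg w(2)] w(2)]
    by (simp only: sqint_minus_commute[of D "grad \<phi>" "wgrad D u"])
qed

text \<open>The constant is 2 * 4 * 2: splitting u into u - \<open>\<phi> k\<close> and
  \<open>\<phi> k\<close>, the inequality for test functions, and splitting the gradient of
  \<open>\<phi> k\<close>. The error terms vanish in the limit.\<close>

lemma H10_poincare:
  assumes D: "open D" and R: "\<And>x. x \<in> D \<Longrightarrow> norm x \<le> R" and u: "H10 D u"
  shows "sqint D u \<le> ennreal (16 * R\<^sup>2) * sqint D (wgrad D u)"
proof -
  obtain \<phi> where \<phi>: "\<And>k. test_fun D (\<phi> k)"
    and l1: "(\<lambda>k. sqint D (\<lambda>x. u x - \<phi> k x)) \<longlonglongrightarrow> 0"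
    and l2: "(\<lambda>k. sqint D (\<lambda>x. wgrad D u x - grad (\<phi> k) x)) \<longlonglongrightarrow> 0"
    and "AE x in lborel. x \<in> D \<longrightarrow> (\<lambda>k. \<phi> k x) \<longlonglongrightarrow> u x"
    by (rule H10_approx[OF D u], rule that)
  have H1: "H1 D u" using u by (simp add: H10_def)
  then have mu: "set_borel_measurable lborel D u" by (simp add: H1_def L2_def)
  let ?P = "ennreal (4 * R\<^sup>2)" and ?S = "sqint D (wgrad D u)"
  let ?e = "\<lambda>k. sqint D (\<lambda>x. wgrad D u x - grad (\<phi> k) x)"
  have "sqint D u \<le> 2 * sqint D (\<lambda>x. u x - \<phi> k x) + 2 * (?P * (2 * ?e k + 2 * ?S))" for k
  proof -
    note m = test_fun_sqint_finite(1)[OF D \<phi>, of k]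
    have "sqint D u \<le> 2 * sqint D (\<lambda>x. u x - \<phi> k x) + 2 * sqint D (\<phi> k)"
      by (rule sqint_le_diff[OF set_borel_measurable_diff[OF mu m] m])
    also have "sqint D (\<phi> k) \<le> ?P * sqint D (grad (\<phi> k))"
      by (rule poincare_test_fun[OF \<phi> R])
    also have "sqint D (grad (\<phi> k)) \<le> 2 * ?e k + 2 * ?S"
      by (rule sqint_grad_le[OF D H1 \<phi>])
    finally show ?thesis by (simp add: add_left_mono mult_left_mono)
  qed
  moreover have "(\<lambda>k. 2 * sqint D (\<lambda>x. u x - \<phi> k x) + 2 * (?P * (2 * ?e k + 2 * ?S))) \<longlonglongrightarrow>
      2 * 0 + 2 * (?P * (2 * 0 + 2 * ?S))"
    by (intro tendsto_add ennreal_tendsto_cmult l1 l2 tendsto_const) auto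
  ultimately have "sqint D u \<le> 2 * 0 + 2 * (?P * (2 * 0 + 2 * ?S))"
    by (intro LIMSEQ_le_const) auto
  also have "\<dots> = 2 * ?P * 2 * ?S" by (simp add: mult.assoc)
  also have "2 * ?P * 2 = ennreal (16 * R\<^sup>2)"
    unfolding ennreal_numeral[symmetric] by (simp add: ennreal_mult[symmetric] del: ennreal_numeral)
  finally show ?thesis .
qed

text \<open>The seminorm bound comes from Fatou along the approximating test functions. Membership
  in \<open>Hs0\<close> needs those functions to converge in the fractional norm as well, so the
  same argument is repeated for differences. The radius \<open>2 * R\<close> bounds distances within
  D.\<close>

lemma H10_gagliardo:
  fixes D :: "'a::euclidean_space set"
  assumes D: "open D" and R: "\<And>x. x \<in> D \<Longrightarrow> norm x \<le> R" "R > 0" and s: "0 \<le> s" "s < 1" and u: "H10 D u"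
  defines "G \<equiv> kernel_mass TYPE('a) (2 * R) (real DIM('a) + 2 * s)"
  shows "gagliardo D s u \<le> 2 * G * sqint D (wgrad D u)" and "Hs0 D s u"
proof -
  obtain \<phi> where \<phi>: "\<And>k. test_fun D (\<phi> k)"
    and l1: "(\<lambda>k. sqint D (\<lambda>x. u x - \<phi> k x)) \<longlonglongrightarrow> 0"
    and l2: "(\<lambda>k. sqint D (\<lambda>x. wgrad D u x - grad (\<phi> k) x)) \<longlonglongrightarrow> 0"
    and l3: "AE x in lborel. x \<in> D \<longrightarrow> (\<lambda>k. \<phi> k x) \<longlonglongrightarrow> u x"
    by (rule H10_approx[OF D u], rule that)
  have H1: "H1 D u" using u by (simp add: H10_def)
  then have L2: "L2 D u" by (simp add: H1_def)
  note w = H1_wgrad[OF D H1]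
  let ?S = "sqint D (wgrad D u)"
  let ?e = "\<lambda>k. sqint D (\<lambda>x. wgrad D u x - grad (\<phi> k) x)"
  \<comment> \<open>Finiteness allows G to be pulled through limits in
    \<open>ennreal\<close>.\<close>
  have G: "G < \<infinity>" unfolding G_def using s R by (intro kernel_mass_finite) auto
  have g: "gagliardo D s \<psi> \<le> G * sqint D (grad \<psi>)" if "test_fun D \<psi>" for \<psi>
    unfolding G_def
  proof (rule gagliardo_test_fun[OF that])
    fix x y assume "x \<in> D" "y \<in> D"
    then show "norm (y - x) \<le> 2 * R" using R(1)[of x] R(1)[of y] norm_triangle_ineq4[of y x] by linarith
  qed
  have cont: "continuous_on UNIV (\<phi> k)" for k by (rule test_fun_D(4)[OF \<phi>])
  have mg: "set_borel_measurable lborel D (grad (\<phi> k))" for k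
    using set_borel_measurable_continuous_UNIV[OF D continuous_on_grad[OF \<phi>]] .
  have "gagliardo D s u \<le> liminf (\<lambda>k. gagliardo D s (\<phi> k))"
    by (rule gagliardo_Fatou[OF D cont l3])
  also have "\<dots> \<le> liminf (\<lambda>k. G * (2 * ?e k + 2 * ?S))"
    by (intro Liminf_mono always_eventually allI order_trans[OF g[OF \<phi>]] mult_left_mono sqint_grad_le[OF D H1 \<phi>]) simp
  also have "(\<lambda>k. G * (2 * ?e k + 2 * ?S)) \<longlonglongrightarrow> G * (2 * 0 + 2 * ?S)"
    using G by (intro tendsto_add ennreal_tendsto_cmult l2 tendsto_const) auto
  then have "liminf (\<lambda>k. G * (2 * ?e k + 2 * ?S)) = G * (2 * 0 + 2 * ?S)"
    by (intro lim_imp_Liminf) auto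
  also have "\<dots> = 2 * G * ?S" by (simp add: mult.assoc mult.left_commute)
  finally show gu: "gagliardo D s u \<le> 2 * G * ?S" .
  have "2 * G * ?S < \<infinity>" using G w(3) by (simp add: ennreal_mult_less_top)
  with gu have fin: "gagliardo D s u < \<infinity>" by (rule order.strict_trans1)
  \<comment> \<open>Here k is fixed while l tends to infinity: the differences of test functions
    converge to u - \<open>\<phi> k\<close>, and only the gradient error of index k
    survives.\<close>
  have gd: "gagliardo D s (\<lambda>x. u x - \<phi> k x) \<le> G * (2 * ?e k)" for k
  proof -
    have "AE x in lborel. x \<in> D \<longrightarrow> (\<lambda>l. \<phi> l x - \<phi> k x) \<longlonglongrightarrow> u x - \<phi> k x"
      using l3 by eventually_elim (auto intro: tendsto_intros)
    then have "gagliardo D s (\<lambda>x. u x - \<phi> k x) \<le> liminf (\<lambda>l. gagliardo D s (\<lambda>x. \<phi> l x - \<phi> k x))"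
      by (intro gagliardo_Fatou[OF D] continuous_intros cont)
    also have "\<dots> \<le> liminf (\<lambda>l. G * (2 * ?e l + 2 * ?e k))"
    proof (intro Liminf_mono always_eventually allI)
      fix l
      have "sqint D (grad (\<lambda>x. \<phi> l x - \<phi> k x)) \<le> 2 * ?e l + 2 * ?e k"
      proof (rule sqint_add_le)
        show "set_borel_measurable lborel D (\<lambda>x. wgrad D u x - grad (\<phi> l) x)"
          "set_borel_measurable lborel D (\<lambda>x. wgrad D u x - grad (\<phi> k) x)"
          by (rule set_borel_measurable_diff[OF w(2) mg])+
        show "norm (grad (\<lambda>x. \<phi> l x - \<phi> k x) x) \<le> norm (wgrad D u x - grad (\<phi> l) x) + norm (wgrad D u x - grad (\<phi> k) x)" for x
          using norm_triangle_ineq4[of "wgrad D u x - grad (\<phi> k) x" "wgrad D u x - grad (\<phi> l) x"]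
          by (simp add: grad_diff[OF \<phi> \<phi>])
      qed
      then show "gagliardo D s (\<lambda>x. \<phi> l x - \<phi> k x) \<le> G * (2 * ?e l + 2 * ?e k)"
        by (intro order_trans[OF g[OF test_fun_diff[OF \<phi> \<phi>]]] mult_left_mono) simp_all
    qed
    also have "(\<lambda>l. G * (2 * ?e l + 2 * ?e k)) \<longlonglongrightarrow> G * (2 * 0 + 2 * ?e k)"
      using G by (intro tendsto_add ennreal_tendsto_cmult l2 tendsto_const) auto
    then have "liminf (\<lambda>l. G * (2 * ?e l + 2 * ?e k)) = G * (2 * 0 + 2 * ?e k)"
      by (intro lim_imp_Liminf) auto
    finally show ?thesis by simp
  qed
  have L2d: "L2 D (\<lambda>x. u x - \<phi> k x)" for k
    using H1_diff_test_fun(1)[OF D H1 \<phi>, of k] by (simp add: H1_def)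
  have "ennreal ((Hs_norm D s (\<lambda>x. u x - \<phi> k x))\<^sup>2) \<le> sqint D (\<lambda>x. u x - \<phi> k x) + G * (2 * ?e k)" for k
  proof -
    have "sqint D (\<lambda>x. wgrad D u x - grad (\<phi> k) x) < \<infinity>"
      using sqint_diff_le[OF w(2) mg[of k]] H1_wgrad(3)[OF D H1_diff_test_fun(1)[OF D H1 \<phi>, of k]]
        sqint_cong_AE[of D "wgrad D (\<lambda>x. u x - \<phi> k x)" "\<lambda>x. wgrad D u x - grad (\<phi> k) x"]
        H1_diff_test_fun(2)[OF D H1 \<phi>, of k] by (simp add: eventually_mono)
    then have "G * (2 * ?e k) < \<infinity>" using G by (simp add: ennreal_mult_less_top)
    then have "gagliardo D s (\<lambda>x. u x - \<phi> k x) < \<infinity>" using gd order.strict_trans1 by blast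
    from Hs_norm_sq[OF L2d this] show ?thesis
      by (rule order_trans) (intro add_left_mono gd)
  qed
  moreover have "(\<lambda>k. sqint D (\<lambda>x. u x - \<phi> k x) + G * (2 * ?e k)) \<longlonglongrightarrow> 0 + G * (2 * 0)"
    using G by (intro tendsto_add ennreal_tendsto_cmult l1 l2) auto
  ultimately have "(\<lambda>k. ennreal ((Hs_norm D s (\<lambda>x. u x - \<phi> k x))\<^sup>2)) \<longlonglongrightarrow> ennreal 0"
    by (intro tendsto_sandwich[OF _ _ tendsto_const, of _ "\<lambda>k. ennreal ((Hs_norm D s (\<lambda>x. u x - \<phi> k x))\<^sup>2)" _ "\<lambda>k. sqint D (\<lambda>x. u x - \<phi> k x) + G * (2 * ?e k)"]) auto
  then have "(\<lambda>k. (Hs_norm D s (\<lambda>x. u x - \<phi> k x))\<^sup>2) \<longlonglongrightarrow> 0"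
    by (subst (asm) tendsto_ennreal_iff) auto
  then have "(\<lambda>k. sqrt ((Hs_norm D s (\<lambda>x. u x - \<phi> k x))\<^sup>2)) \<longlonglongrightarrow> sqrt 0"
    by (rule tendsto_real_sqrt)
  then have "(\<lambda>k. Hs_norm D s (\<lambda>x. u x - \<phi> k x)) \<longlonglongrightarrow> 0"
    by (simp add: Hs_norm_nonneg)
  then show "Hs0 D s u" unfolding Hs0_def using L2 fin \<phi> by blast
qed

section \<open>Norm comparisons and the dual pairing in terms of the gradient seminorm\<close>

definition grad_norm :: "'a::euclidean_space set \<Rightarrow> ('a \<Rightarrow> real) \<Rightarrow> real" where
  "grad_norm D u = sqrt (LINT x:D|lborel. (norm (wgrad D u x))\<^sup>2)"

lemma grad_norm_nonneg: "0 \<le> grad_norm D u"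
  unfolding grad_norm_def by (intro real_sqrt_ge_zero set_integral_norm_sq_nonneg)

lemma grad_norm_sq: "(grad_norm D u)\<^sup>2 = (LINT x:D|lborel. (norm (wgrad D u x))\<^sup>2)"
  unfolding grad_norm_def by (intro real_sqrt_pow2 set_integral_norm_sq_nonneg)

lemma sqint_wgrad:
  assumes "open D" "H1 D u"
  shows "sqint D (wgrad D u) = ennreal ((grad_norm D u)\<^sup>2)"
  unfolding grad_norm_sq
  by (rule sqint_eq_integral)
    (simp only: set_integrable_iff_sqint[OF H1_wgrad(2)[OF assms]] H1_wgrad(3)[OF assms])

lemma H1_norm_le_grad_norm:
  assumes D: "open D" and R: "\<And>x. x \<in> D \<Longrightarrow> norm x \<le> R" and u: "H10 D u"
  shows "(H1_norm D u)\<^sup>2 \<le> (16 * R\<^sup>2 + 1) * (grad_norm D u)\<^sup>2"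
proof -
  have H1: "H1 D u" using u by (simp add: H10_def)
  have "ennreal ((H1_norm D u)\<^sup>2) \<le> ennreal (16 * R\<^sup>2) * ennreal ((grad_norm D u)\<^sup>2) + ennreal ((grad_norm D u)\<^sup>2)"
    unfolding H1_norm_sq[OF D H1] using H10_poincare[OF D R u]
    by (simp add: sqint_wgrad[OF D H1] add_right_mono)
  also have "\<dots> = ennreal ((16 * R\<^sup>2 + 1) * (grad_norm D u)\<^sup>2)"
    by (simp add: ennreal_mult[symmetric] ennreal_plus[symmetric] algebra_simps del: ennreal_plus)
  finally show ?thesis by (subst (asm) ennreal_le_iff) auto
qed

lemma Hs_norm_le_grad_norm:
  fixes D :: "'a::euclidean_space set"
  assumes D: "open D" and R: "\<And>x. x \<in> D \<Longrightarrow> norm x \<le> R" "R > 0" and s: "0 \<le> s" "s < 1"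
  obtains K where "K \<ge> 0" "\<And>u. H10 D u \<Longrightarrow> Hs_norm D s u \<le> K * grad_norm D u"
proof
  define G where "G = kernel_mass TYPE('a) (2 * R) (real DIM('a) + 2 * s)"
  have G: "G < \<infinity>" unfolding G_def using s R by (intro kernel_mass_finite) auto
  define c where "c = 16 * R\<^sup>2 + 2 * enn2real G"
  have c: "c \<ge> 0" by (simp add: c_def)
  then show "sqrt c \<ge> 0" by simp
  fix u assume u: "H10 D u"
  have H1: "H1 D u" using u by (simp add: H10_def)
  have L2: "L2 D u" using H1 by (simp add: H1_def)
  have g: "gagliardo D s u \<le> 2 * G * sqint D (wgrad D u)"
    unfolding G_def by (rule H10_gagliardo(1)[OF D R s u])
  have P: "sqint D u \<le> ennreal (16 * R\<^sup>2) * sqint D (wgrad D u)"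
    by (rule H10_poincare[OF D R(1) u])
  have G2: "2 * G = ennreal (2 * enn2real G)"
    using G by (simp add: ennreal_mult ennreal_enn2real)
  have "2 * G * sqint D (wgrad D u) < \<infinity>" using G H1_wgrad(3)[OF D H1] by (simp add: ennreal_mult_less_top)
  with g have "gagliardo D s u < \<infinity>" by (rule order.strict_trans1)
  then have "ennreal ((Hs_norm D s u)\<^sup>2) \<le> sqint D u + gagliardo D s u" by (rule Hs_norm_sq[OF L2])
  also have "\<dots> \<le> ennreal (16 * R\<^sup>2) * ennreal ((grad_norm D u)\<^sup>2) + ennreal (2 * enn2real G) * ennreal ((grad_norm D u)\<^sup>2)"
    using add_mono[OF P g] by (simp only: sqint_wgrad[OF D H1] G2)
  also have "\<dots> = ennreal (16 * R\<^sup>2 * (grad_norm D u)\<^sup>2 + 2 * enn2real G * (grad_norm D u)\<^sup>2)"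
    by (subst ennreal_plus) (simp_all only: ennreal_mult zero_le_power2 enn2real_nonneg zero_le_numeral mult_nonneg_nonneg)
  also have "\<dots> = ennreal (c * (grad_norm D u)\<^sup>2)"
    by (simp only: c_def distrib_right)
  finally have "(Hs_norm D s u)\<^sup>2 \<le> c * (grad_norm D u)\<^sup>2"
    using ennreal_le_iff[of "c * (grad_norm D u)\<^sup>2"] c by simp
  also have "\<dots> = (sqrt c * grad_norm D u)\<^sup>2" using c by (simp add: power_mult_distrib)
  finally show "Hs_norm D s u \<le> sqrt c * grad_norm D u"
    by (rule power2_le_imp_le) (intro mult_nonneg_nonneg real_sqrt_ge_zero c grad_norm_nonneg)
qed

text \<open>Continuity of F bounds the set of quotients, so its real supremum is meaningful; the
  inserted 0 gives the sign. Functions with \<open>Hs_norm\<close> equal to 0 do not occur among the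
  quotients, and for them continuity forces F v = 0.\<close>

lemma Hneg_norm_nonneg_bound:
  assumes F: "Hneg D s F"
  shows "0 \<le> Hneg_norm D s F" and "Hs0 D s v \<Longrightarrow> \<bar>F v\<bar> \<le> Hneg_norm D s F * Hs_norm D s v"
proof -
  let ?A = "insert 0 {\<bar>F v\<bar> / Hs_norm D s v | v. Hs0 D s v \<and> Hs_norm D s v \<noteq> 0}"
  obtain C where C: "\<And>v. Hs0 D s v \<Longrightarrow> \<bar>F v\<bar> \<le> C * Hs_norm D s v" using F unfolding Hneg_def by blast
  have bdd: "bdd_above ?A"
  proof (rule bdd_aboveI)
    fix y assume "y \<in> ?A"
    then consider "y = 0" | v where "y = \<bar>F v\<bar> / Hs_norm D s v" "Hs0 D s v" "Hs_norm D s v \<noteq> 0" by blast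
    then show "y \<le> max C 0"
    proof cases
      case 2
      then have "Hs_norm D s v > 0" using Hs_norm_nonneg[of D s v] by linarith
      then have "y \<le> C" using C[OF 2(2)] 2(1) by (simp add: divide_le_eq)
      then show ?thesis by simp
    qed simp
  qed
  show "0 \<le> Hneg_norm D s F" unfolding Hneg_norm_def by (rule cSup_upper[OF _ bdd]) simp
  assume v: "Hs0 D s v"
  show "\<bar>F v\<bar> \<le> Hneg_norm D s F * Hs_norm D s v"
  proof (cases "Hs_norm D s v = 0")
    case True then show ?thesis using C[OF v] by simp
  next
    case False
    then have p: "Hs_norm D s v > 0" using Hs_norm_nonneg[of D s v] by linarith
    have "\<bar>F v\<bar> / Hs_norm D s v \<le> Hneg_norm D s F"
      unfolding Hneg_norm_def by (rule cSup_upper[OF _ bdd]) (use v False in blast)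
    then show ?thesis using p by (simp add: divide_le_eq)
  qed
qed

section \<open>Coercivity and boundedness of the bilinear form\<close>

lemma aform_integrable:
  assumes D: "open D" and a: "set_borel_measurable lborel D a" "AE x in lborel. x \<in> D \<longrightarrow> \<bar>a x\<bar> \<le> C"
    and u: "H1 D u" and v: "H1 D v"
  shows "set_integrable lborel D (\<lambda>x. a x * (wgrad D u x \<bullet> wgrad D v x))"
proof -
  note wu = H1_wgrad[OF D u] and wv = H1_wgrad[OF D v]
  have iu: "integrable lborel (\<lambda>x. indicator D x *\<^sub>R (norm (wgrad D u x))\<^sup>2)"
    using set_integrable_iff_sqint[OF wu(2)] wu(3) by (simp add: set_integrable_def)
  have iv: "integrable lborel (\<lambda>x. indicator D x *\<^sub>R (norm (wgrad D v x))\<^sup>2)"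
    using set_integrable_iff_sqint[OF wv(2)] wv(3) by (simp add: set_integrable_def)
  note [measurable] = a(1)[unfolded set_borel_measurable_def] wu(2)[unfolded set_borel_measurable_def]
    wv(2)[unfolded set_borel_measurable_def]
  have "(\<lambda>x. (indicator D x *\<^sub>R a x) * ((indicator D x *\<^sub>R wgrad D u x) \<bullet> (indicator D x *\<^sub>R wgrad D v x))) \<in> borel_measurable lborel"
    by measurable
  moreover have "(\<lambda>x. (indicator D x *\<^sub>R a x) * ((indicator D x *\<^sub>R wgrad D u x) \<bullet> (indicator D x *\<^sub>R wgrad D v x)))
     = (\<lambda>x. indicator D x *\<^sub>R (a x * (wgrad D u x \<bullet> wgrad D v x)))"
    by (intro ext) (simp split: split_indicator)
  ultimately have m: "(\<lambda>x. indicator D x *\<^sub>R (a x * (wgrad D u x \<bullet> wgrad D v x))) \<in> borel_measurable lborel" by (simp only:)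
  show ?thesis unfolding set_integrable_def
  proof (rule Bochner_Integration.integrable_bound[OF _ m])
    \<comment> \<open>The product of the two gradient norms is bounded by the sum of their squares;
      the absolute value spares a sign condition on C.\<close>
    show "integrable lborel (\<lambda>x. \<bar>C\<bar> * (indicator D x *\<^sub>R (norm (wgrad D u x))\<^sup>2 + indicator D x *\<^sub>R (norm (wgrad D v x))\<^sup>2))"
      by (intro integrable_mult_right Bochner_Integration.integrable_add iu iv)
    show "AE x in lborel. norm (indicator D x *\<^sub>R (a x * (wgrad D u x \<bullet> wgrad D v x)))
       \<le> norm (\<bar>C\<bar> * (indicator D x *\<^sub>R (norm (wgrad D u x))\<^sup>2 + indicator D x *\<^sub>R (norm (wgrad D v x))\<^sup>2))"
      using a(2)
    proof eventually_elim
      case (elim x)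
      show ?case
      proof (cases "x \<in> D")
        case True
        have "\<bar>wgrad D u x \<bullet> wgrad D v x\<bar> \<le> norm (wgrad D u x) * norm (wgrad D v x)"
          by (rule Cauchy_Schwarz_ineq2)
        also have "\<dots> \<le> (norm (wgrad D u x))\<^sup>2 + (norm (wgrad D v x))\<^sup>2"
          using sum_squares_bound[of "norm (wgrad D u x)" "norm (wgrad D v x)"]
            mult_nonneg_nonneg[OF norm_ge_zero[of "wgrad D u x"] norm_ge_zero[of "wgrad D v x"]] by linarith
        finally have "\<bar>a x\<bar> * \<bar>wgrad D u x \<bullet> wgrad D v x\<bar> \<le> \<bar>C\<bar> * ((norm (wgrad D u x))\<^sup>2 + (norm (wgrad D v x))\<^sup>2)"
          using elim True by (intro mult_mono) auto
        then show ?thesis using True by (simp add: abs_mult)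
      qed simp
    qed
  qed
qed

lemma aform_coercive:
  assumes D: "open D" and a: "set_borel_measurable lborel D a" "AE x in lborel. x \<in> D \<longrightarrow> \<bar>a x\<bar> \<le> C"
    and c: "AE x in lborel. x \<in> D \<longrightarrow> c \<le> a x" and u: "H1 D u"
  shows "c * (grad_norm D u)\<^sup>2 \<le> aform D a u u"
proof -
  have i: "set_integrable lborel D (\<lambda>x. (norm (wgrad D u x))\<^sup>2)"
    using set_integrable_iff_sqint[OF H1_wgrad(2)[OF D u]] H1_wgrad(3)[OF D u] by blast
  have "c * (grad_norm D u)\<^sup>2 = (LINT x:D|lborel. c * (norm (wgrad D u x))\<^sup>2)"
    by (simp add: grad_norm_sq)
  also have "\<dots> \<le> aform D a u u" unfolding aform_def set_lebesgue_integral_def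
  proof (rule integral_mono_AE)
    show "integrable lborel (\<lambda>x. indicator D x *\<^sub>R (c * (norm (wgrad D u x))\<^sup>2))"
      using set_integrable_mult_right[of c, OF i] by (simp add: set_integrable_def)
    show "integrable lborel (\<lambda>x. indicator D x *\<^sub>R (a x * (wgrad D u x \<bullet> wgrad D u x)))"
      using aform_integrable[OF D a u u] by (simp add: set_integrable_def)
    show "AE x in lborel. indicator D x *\<^sub>R (c * (norm (wgrad D u x))\<^sup>2) \<le> indicator D x *\<^sub>R (a x * (wgrad D u x \<bullet> wgrad D u x))"
      using c by eventually_elim (auto simp: power2_norm_eq_inner mult_right_mono split: split_indicator)
  qed
  finally show ?thesis .
qed

text \<open>The weights are fitted to coercivity: with v the next iterate, \<open>c / 2\<close>
  times its squared seminorm is absorbed, leaving the ratio (b / c)^2 that Cauchy-Schwarz would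
  give. Only a pointwise inequality has to be integrated.\<close>

lemma aform_young:
  assumes D: "open D" and a: "set_borel_measurable lborel D a" "AE x in lborel. x \<in> D \<longrightarrow> \<bar>a x\<bar> \<le> b"
    and c: "c > 0" and u: "H1 D u" and v: "H1 D v"
  shows "- aform D a u v \<le> b\<^sup>2 / (2 * c) * (grad_norm D u)\<^sup>2 + c / 2 * (grad_norm D v)\<^sup>2"
proof -
  have iu: "set_integrable lborel D (\<lambda>x. (norm (wgrad D u x))\<^sup>2)"
    using set_integrable_iff_sqint[OF H1_wgrad(2)[OF D u]] H1_wgrad(3)[OF D u] by blast
  have iv: "set_integrable lborel D (\<lambda>x. (norm (wgrad D v x))\<^sup>2)"
    using set_integrable_iff_sqint[OF H1_wgrad(2)[OF D v]] H1_wgrad(3)[OF D v] by blast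
  let ?k = "b\<^sup>2 / (2 * c)"
  note ia = aform_integrable[OF D a u v]
  note iw = set_integral_add[OF set_integrable_mult_right[of ?k, OF iu] set_integrable_mult_right[of "c / 2", OF iv]]
  have "- aform D a u v = (\<integral>x. - (indicator D x *\<^sub>R (a x * (wgrad D u x \<bullet> wgrad D v x))) \<partial>lborel)"
    unfolding aform_def set_lebesgue_integral_def by simp
  also have "\<dots> \<le> (\<integral>x. indicator D x *\<^sub>R (?k * (norm (wgrad D u x))\<^sup>2 + c / 2 * (norm (wgrad D v x))\<^sup>2) \<partial>lborel)"
  proof (rule integral_mono_AE)
    show "integrable lborel (\<lambda>x. - (indicator D x *\<^sub>R (a x * (wgrad D u x \<bullet> wgrad D v x))))"
      using ia by (simp add: set_integrable_def)
    show "integrable lborel (\<lambda>x. indicator D x *\<^sub>R (?k * (norm (wgrad D u x))\<^sup>2 + c / 2 * (norm (wgrad D v x))\<^sup>2))"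
      using iw(1) unfolding set_integrable_def .
    show "AE x in lborel. - (indicator D x *\<^sub>R (a x * (wgrad D u x \<bullet> wgrad D v x)))
       \<le> indicator D x *\<^sub>R (?k * (norm (wgrad D u x))\<^sup>2 + c / 2 * (norm (wgrad D v x))\<^sup>2)"
      using a(2)
    proof eventually_elim
      case (elim x)
      show ?case
      proof (cases "x \<in> D")
        case True
        let ?n = "norm (wgrad D u x)" and ?m = "norm (wgrad D v x)"
        have "- (a x * (wgrad D u x \<bullet> wgrad D v x)) \<le> \<bar>a x\<bar> * \<bar>wgrad D u x \<bullet> wgrad D v x\<bar>"
          unfolding abs_mult[symmetric] by simp
        also have "\<dots> \<le> b * (?n * ?m)"
          \<comment> \<open>Nonnegativity of b is read off from the pointwise bound on
            \<open>\<bar>a x\<bar>\<close>.\<close>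
          using elim True Cauchy_Schwarz_ineq2[of "wgrad D u x" "wgrad D v x"] by (intro mult_mono) auto
        also have "\<dots> \<le> ?k * ?n\<^sup>2 + c / 2 * ?m\<^sup>2"
        proof -
          have "0 \<le> (b * ?n - c * ?m)\<^sup>2 / (2 * c)" using c by simp
          also have "\<dots> = ?k * ?n\<^sup>2 + c / 2 * ?m\<^sup>2 - b * (?n * ?m)"
            using c by (simp add: power2_eq_square field_simps)
          finally show ?thesis by simp
        qed
        finally show ?thesis using True by simp
      qed simp
    qed
  qed
  also have "\<dots> = ?k * (grad_norm D u)\<^sup>2 + c / 2 * (grad_norm D v)\<^sup>2"
    unfolding set_lebesgue_integral_def[symmetric] iw(2) by (simp add: grad_norm_sq)
  finally show ?thesis .
qed

text \<open>\<open>real_of_ereal\<close> would turn an infinite essential supremum into 0, so the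
  essential bound in \<open>W1inf\<close> is first used to exclude that value. If the supremum is
  minus infinity, almost no point lies in D.\<close>

lemma W1inf_norm_bound:
  assumes D: "open D" and a: "W1inf D a" and b: "W1inf_norm D a \<le> b"
  shows "AE x in lborel. x \<in> D \<longrightarrow> \<bar>a x\<bar> \<le> b"
proof -
  let ?E = "esssup (restrict_space lborel D) (\<lambda>x. ereal \<bar>a x\<bar>)"
  have [measurable]: "D \<in> sets borel" using D by simp
  have "a \<in> borel_measurable (restrict_space lborel D)"
    using a D by (subst borel_measurable_restrict_space_iff) (auto simp: W1inf_def set_borel_measurable_def)
  then have m: "(\<lambda>x. ereal \<bar>a x\<bar>) \<in> borel_measurable (restrict_space lborel D)" by measurable
  obtain C where C: "AE x in lborel. x \<in> D \<longrightarrow> \<bar>a x\<bar> \<le> C" using a by (auto simp: W1inf_def)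
  have "?E \<le> ereal C"
    using C by (intro esssup_I[OF m]) (simp add: AE_restrict_space_iff)
  then have "?E \<noteq> \<infinity>" by auto
  moreover have "real_of_ereal ?E \<le> b" using b by (simp add: W1inf_norm_def)
  moreover have "AE x in lborel. x \<in> D \<longrightarrow> ereal \<bar>a x\<bar> \<le> ?E"
    using esssup_AE[of "\<lambda>x. ereal \<bar>a x\<bar>" "restrict_space lborel D"] by (simp add: AE_restrict_space_iff)
  ultimately show ?thesis by (cases ?E) (auto elim!: eventually_mono)
qed

section \<open>Pathwise energy estimates along the recursion and their expectation\<close>

theorem theorem4p1:
  fixes D :: "'a::euclidean_space set"
    and M :: "'w measure"
    and a0 :: "'a \<Rightarrow> real"
    and \<eta> :: "'w \<Rightarrow> 'a \<Rightarrow> real"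
    and f :: "'w \<Rightarrow> ('a \<Rightarrow> real) \<Rightarrow> real"
    and \<sigma> b0 \<kappa> :: real
    and T :: "'a set set"
    and r :: nat
    and u :: "nat \<Rightarrow> 'w \<Rightarrow> 'a \<Rightarrow> real"
  assumes dim: "DIM('a) \<in> {1, 2, 3}"
    and dom: "lipschitz_domain D"
    and prob: "prob_space M"
    and a0_W: "W1inf D a0"
    and a0_pos: "\<exists>c>0. AE x in lborel. x \<in> D \<longrightarrow> c \<le> a0 x"
    and eta_W: "\<forall>\<omega>\<in>space M. W1inf D (\<eta> \<omega>)"
    and eta_meas: "(\<lambda>\<omega>. W1inf_norm D (\<eta> \<omega>)) \<in> borel_measurable M"
    and eta_L2: "(\<integral>\<^sup>+\<omega>. ennreal ((W1inf_norm D (\<eta> \<omega>))^2) \<partial>M) < \<infinity>"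
    and b0_pos: "b0 > 0"
    and eta_bd: "AE \<omega> in M. W1inf_norm D (\<eta> \<omega>) \<le> b0"
    and sigma: "0 < \<sigma>" "\<sigma> \<le> 1"
    and f_H: "\<forall>\<omega>\<in>space M. Hneg D (1 - \<sigma>) (f \<omega>)"
    and f_meas: "\<forall>v. Hs0 D (1 - \<sigma>) v \<longrightarrow> (\<lambda>\<omega>. f \<omega> v) \<in> borel_measurable M"
    and f_norm_meas: "(\<lambda>\<omega>. Hneg_norm D (1 - \<sigma>) (f \<omega>)) \<in> borel_measurable M"
    and f_L2: "(\<integral>\<^sup>+\<omega>. ennreal ((Hneg_norm D (1 - \<sigma>) (f \<omega>))^2) \<partial>M) < \<infinity>"
    and tri: "triangulation D T"
    and qu: "quasi_uniform \<kappa> T"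
    and r: "r \<ge> 1"
    and u_V: "\<forall>\<omega>\<in>space M. \<forall>n. u n \<omega> \<in> Vh D T r"
    and u0: "\<forall>\<omega>\<in>space M. \<forall>v\<in>Vh D T r. aform D a0 (u 0 \<omega>) v = f \<omega> v"
    and un: "\<forall>\<omega>\<in>space M. \<forall>n. \<forall>v\<in>Vh D T r.
               aform D a0 (u (Suc n) \<omega>) v = - aform D (\<eta> \<omega>) (u n \<omega>) v"
  shows "\<exists>C0. \<forall>n. (\<integral>\<^sup>+\<omega>. ennreal ((H1_norm D (u n \<omega>))^2) \<partial>M)
                  \<le> ennreal (C0 ^ (n + 1)) * (\<integral>\<^sup>+\<omega>. ennreal ((Hneg_norm D (1 - \<sigma>) (f \<omega>))^2) \<partial>M)"
proof -
  have D: "open D" and "bounded D" using dom by (auto simp: lipschitz_domain_def)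
  then obtain R where R: "R > 0" "\<And>x. x \<in> D \<Longrightarrow> norm x \<le> R" using bounded_pos by metis
  let ?s = "1 - \<sigma>"
  obtain K where K: "K \<ge> 0" "\<And>v. H10 D v \<Longrightarrow> Hs_norm D ?s v \<le> K * grad_norm D v"
    using Hs_norm_le_grad_norm[OF D R(2,1), of ?s] sigma by auto
  obtain c where c: "c > 0" "AE x in lborel. x \<in> D \<longrightarrow> c \<le> a0 x" using a0_pos by blast
  obtain A where a0: "set_borel_measurable lborel D a0" "AE x in lborel. x \<in> D \<longrightarrow> \<bar>a0 x\<bar> \<le> A"
    using a0_W by (auto simp: W1inf_def)
  \<comment> \<open>q is the growth factor per step. B collects the Poincare constant and the bound
    for the initial iterate; both are fixed before \<omega> and n.\<close>
  define q where "q = (b0 / c)\<^sup>2"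
  define B where "B = (16 * R\<^sup>2 + 1) * (K / c)\<^sup>2"
  let ?N = "\<lambda>\<omega>. Hneg_norm D ?s (f \<omega>)"
  have u_H10: "H10 D (u n \<omega>)" if "\<omega> \<in> space M" for n \<omega>
    using u_V that by (auto simp: Vh_def)
  then have u_H1: "H1 D (u n \<omega>)" if "\<omega> \<in> space M" for n \<omega>
    using that by (simp add: H10_def)
  have init: "(grad_norm D (u 0 \<omega>))\<^sup>2 \<le> (K / c)\<^sup>2 * (?N \<omega>)\<^sup>2" if \<omega>: "\<omega> \<in> space M" for \<omega>
  proof -
    let ?v = "u 0 \<omega>" and ?g = "grad_norm D (u 0 \<omega>)"
    note F = Hneg_norm_nonneg_bound[OF f_H[rule_format, OF \<omega>]]
    have "c * ?g\<^sup>2 \<le> f \<omega> ?v"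
    proof -
      have "aform D a0 ?v ?v = f \<omega> ?v" using u0 u_V \<omega> by blast
      then show ?thesis using aform_coercive[OF D a0 c(2) u_H1[OF \<omega>, of 0]] by simp
    qed
    also have "\<dots> \<le> ?N \<omega> * Hs_norm D ?s ?v"
    proof -
      have "Hs0 D ?s ?v"
        by (rule H10_gagliardo(2)[OF D R(2,1)]) (use sigma u_H10[OF \<omega>, of 0] in auto)
      from F(2)[OF this] show ?thesis by simp
    qed
    also have "\<dots> \<le> ?N \<omega> * (K * ?g)"
      by (intro mult_left_mono K(2) u_H10 \<omega> F(1))
    finally have "?g * (c * ?g) \<le> ?g * (?N \<omega> * K)" by (simp add: power2_eq_square mult_ac)
    \<comment> \<open>One factor \<open>?g\<close> is cancelled; if it is 0, the claim is just
      nonnegativity of the right-hand side.\<close>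
    then have "c * ?g \<le> ?N \<omega> * K"
      using grad_norm_nonneg[of D ?v] F(1) K(1) by (cases "?g = 0") (auto simp: mult_le_cancel_left)
    then have "?g \<le> K / c * ?N \<omega>" using c(1) by (simp add: field_simps)
    then have "?g\<^sup>2 \<le> (K / c * ?N \<omega>)\<^sup>2" using grad_norm_nonneg by (intro power_mono)
    then show ?thesis by (simp only: power_mult_distrib)
  qed
  have step: "(grad_norm D (u (Suc n) \<omega>))\<^sup>2 \<le> q * (grad_norm D (u n \<omega>))\<^sup>2"
    if \<omega>: "\<omega> \<in> space M" and b: "W1inf_norm D (\<eta> \<omega>) \<le> b0" for n \<omega>
  proof -
    let ?g = "(grad_norm D (u n \<omega>))\<^sup>2" and ?g' = "(grad_norm D (u (Suc n) \<omega>))\<^sup>2"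
    have W: "W1inf D (\<eta> \<omega>)" using eta_W \<omega> by blast
    have "c * ?g' \<le> - aform D (\<eta> \<omega>) (u n \<omega>) (u (Suc n) \<omega>)"
    proof -
      have "aform D a0 (u (Suc n) \<omega>) (u (Suc n) \<omega>) = - aform D (\<eta> \<omega>) (u n \<omega>) (u (Suc n) \<omega>)"
        using un u_V \<omega> by blast
      then show ?thesis using aform_coercive[OF D a0 c(2) u_H1[OF \<omega>, of "Suc n"]] by simp
    qed
    also have "\<dots> \<le> b0\<^sup>2 / (2 * c) * ?g + c / 2 * ?g'"
      using W by (intro aform_young[OF D _ W1inf_norm_bound[OF D W b] c(1) u_H1[OF \<omega>] u_H1[OF \<omega>]])
        (simp add: W1inf_def)
    finally have "c / 2 * ?g' \<le> b0\<^sup>2 / (2 * c) * ?g" by simp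
    then show ?thesis using c(1) by (simp add: q_def power2_eq_square field_simps)
  qed
  \<comment> \<open>B occurs once and q occurs n times, against the exponent n + 1. Replacing both
    by their maximum with 1 makes the surplus powers harmless.\<close>
  have all: "(H1_norm D (u n \<omega>))\<^sup>2 \<le> (max 1 B * max 1 q) ^ (n + 1) * (?N \<omega>)\<^sup>2"
    if \<omega>: "\<omega> \<in> space M" and b: "W1inf_norm D (\<eta> \<omega>) \<le> b0" for n \<omega>
  proof -
    have q: "q \<ge> 0" by (simp add: q_def)
    have g: "(grad_norm D (u n \<omega>))\<^sup>2 \<le> q ^ n * ((K / c)\<^sup>2 * (?N \<omega>)\<^sup>2)"
    proof (induction n)
      case 0 then show ?case using init[OF \<omega>] by simp
    next
      case (Suc n)
      have "(grad_norm D (u (Suc n) \<omega>))\<^sup>2 \<le> q * (grad_norm D (u n \<omega>))\<^sup>2" by (rule step[OF \<omega> b])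
      also have "\<dots> \<le> q * (q ^ n * ((K / c)\<^sup>2 * (?N \<omega>)\<^sup>2))" by (intro mult_left_mono Suc q)
      finally show ?case by simp
    qed
    have "(H1_norm D (u n \<omega>))\<^sup>2 \<le> (16 * R\<^sup>2 + 1) * (grad_norm D (u n \<omega>))\<^sup>2"
      by (rule H1_norm_le_grad_norm[OF D R(2) u_H10[OF \<omega>]])
    also have "\<dots> \<le> (16 * R\<^sup>2 + 1) * (q ^ n * ((K / c)\<^sup>2 * (?N \<omega>)\<^sup>2))"
      by (intro mult_left_mono g) simp
    also have "\<dots> = B * q ^ n * (?N \<omega>)\<^sup>2" by (simp add: B_def)
    also have "\<dots> \<le> (max 1 B * max 1 q) ^ (n + 1) * (?N \<omega>)\<^sup>2"
    proof (intro mult_right_mono)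
      have "B \<le> max 1 B ^ (n + 1)"
        using self_le_power[of "max 1 B" "n + 1"] by simp
      moreover have "q ^ n \<le> max 1 q ^ (n + 1)"
        by (rule order_trans[OF power_mono[of q "max 1 q" n] power_increasing[of n "n + 1" "max 1 q"]]) (use q in auto)
      ultimately show "B * q ^ n \<le> (max 1 B * max 1 q) ^ (n + 1)"
        unfolding power_mult_distrib using q by (intro mult_mono) auto
    qed simp
    finally show ?thesis .
  qed
  have "(\<integral>\<^sup>+\<omega>. ennreal ((H1_norm D (u n \<omega>))^2) \<partial>M)
      \<le> ennreal ((max 1 B * max 1 q) ^ (n + 1)) * (\<integral>\<^sup>+\<omega>. ennreal ((?N \<omega>)^2) \<partial>M)" for n
  proof -
    have p: "0 \<le> (max 1 B * max 1 q) ^ (n + 1)" by (intro zero_le_power mult_nonneg_nonneg) auto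
    have "(\<integral>\<^sup>+\<omega>. ennreal ((H1_norm D (u n \<omega>))^2) \<partial>M)
      \<le> (\<integral>\<^sup>+\<omega>. ennreal ((max 1 B * max 1 q) ^ (n + 1)) * ennreal ((?N \<omega>)^2) \<partial>M)"
    proof (rule nn_integral_mono_AE)
      show "AE \<omega> in M. ennreal ((H1_norm D (u n \<omega>))^2) \<le> ennreal ((max 1 B * max 1 q) ^ (n + 1)) * ennreal ((?N \<omega>)^2)"
        \<comment> \<open>The bound on \<open>\<eta> \<omega>\<close> fails on a single null set of
          \<omega>, which does not depend on n.\<close>
        using eta_bd AE_space
      proof eventually_elim
        case (elim \<omega>)
        show ?case unfolding ennreal_mult[OF p zero_le_power2, symmetric]
          by (rule ennreal_leI) (rule all[OF elim(2,1)])
      qed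
    qed
    also have "\<dots> = ennreal ((max 1 B * max 1 q) ^ (n + 1)) * (\<integral>\<^sup>+\<omega>. ennreal ((?N \<omega>)^2) \<partial>M)"
      using f_norm_meas by (intro nn_integral_cmult) measurable
    finally show ?thesis .
  qed
  then show ?thesis by blast
qed

end
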